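(* Let $X=\mathbb{F}^n$ with $\mathbb{F}=\mathbb{R}$ or $\mathbb{C}$. For blades $A\in\bigwedge^pX$ and $B\in\bigwedge^qX$, $\|A\lrcorner B\|=\|A\|\,\|B\|\cos\Theta_{[A],[B]}$. If $p=q$, then $|\langle A,B\rangle|=\|A\|\,\|B\|\cos\Theta_{[A],[B]}$.
   Context: $X=\mathbb{F}^n$ carries an inner product $\langle\cdot,\cdot\rangle$ (Hermitian, conjugate linear in the first entry, if $\mathbb{F}=\mathbb{C}$). The exterior algebra $\bigwedge X=\bigoplus_p\bigwedge^pX$ has the inner product with $\langle v_1\wedge\cdots\wedge v_p,w_1\wedge\cdots\wedge w_p\rangle=\det(\langle v_i,w_j\rangle)$, $\langle\kappa,\lambda\rangle=\bar\kappa\lambda$ for scalars in $\bigwedge^0X=\mathbb{F}$, and distinct grades orthogonal. A $p$-blade is an element $A=v_1\wedge\cdots\wedge v_p$; if nonzero it represents the $p$-dimensional subspace $[A]=\mathrm{span}\{v_1,\dots,v_p\}$; scalars are $0$-blades, with $[\lambda]=\{0\}$. If $A$ or $B$ is zero, the formulas are read as $0=0$. The contraction $A\lrcorner B$ of $A,B\in\bigwedge X$ is defined by $\langle C,A\lrcorner B\rangle=\langle A\wedge C,B\rangle$ for all $C\in\bigwedge X$. For a subspace $W$, $P_W$ also denotes the orthogonal projection $\bigwedge X\to\bigwedge W$. Asymmetric angle: for subspaces $V,W$ of $X$ (any dimensions) and any blade $A$ representing $V$, $\Theta_{V,W}=\cos^{-1}\frac{\|P_WA\|}{\|A\|}\in[0,\frac\pi2]$.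 *)

theory Defs
  imports
    "Jordan_Normal_Form.Determinant"
    "Jordan_Normal_Form.Conjugate"
    "HOL-Analysis.Analysis"
begin

no_notation vec_index (infixl "$" 100)

section \<open>The scalar fields\<close>

text \<open>
  The class comprises exactly the real and the complex numbers (see the two instances, and
  lemma \<open>real_or_complex_cases\<close> for the converse). On \<^typ>\<open>real\<close>
  conjugation is the identity, on \<^typ>\<open>complex\<close> it is \<^const>\<open>cnj\<close>.
\<close>

class real_or_complex = real_normed_field + conjugatable_field +
  assumes mult_conjugate_scaleR: "x * conjugate x = (norm x)\<^sup>2 *\<^sub>R 1"

lemma mult_conjugate: "x * conjugate x = of_real ((norm x)\<^sup>2)" for x :: "'k::real_or_complex"
  by (simp add: mult_conjugate_scaleR of_real_def)

instance real :: real_or_complex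
  by standard (simp add: power2_eq_square)

instance complex :: real_or_complex
proof
  fix x :: complex
  show "x * conjugate x = (norm x)\<^sup>2 *\<^sub>R 1"
    using complex_norm_square[of x] by (simp only: scaleR_conv_of_real conjugate_complex_def mult_1_right)
qed

lemma conjugate_of_real [simp]:
  "conjugate (of_real r :: 'k::real_or_complex) = of_real r"
proof (cases "r = 0")
  case False
  then have "(of_real r :: 'k) \<noteq> 0" by simp
  moreover have "(of_real r :: 'k) * conjugate (of_real r) = of_real r * of_real r"
    by (simp add: mult_conjugate power2_eq_square)
  ultimately show ?thesis by (metis mult_left_cancel)
qed simp

lemma real_or_complex_cases:
  "(\<forall>x::'k::real_or_complex. x \<in> range of_real) \<or>
   (\<exists>j::'k. j * j = - 1 \<and> (\<forall>x. \<exists>a b. x = of_real a + of_real b * j))"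
proof (cases "\<forall>x::'k. x \<in> range of_real")
  case False
  have self_adjoint_real: "t \<in> range of_real" if "conjugate t = t" for t :: 'k
  proof -
    have "t * t = of_real (norm t) * of_real (norm t)"
      using mult_conjugate[of t] that by (simp add: power2_eq_square)
    then have "t = of_real (norm t) \<or> t = of_real (- norm t)"
      by (simp add: square_eq_iff)
    then show ?thesis by blast
  qed
  from False obtain y :: 'k where y: "y \<notin> range of_real" by blast
  define u where "u = y - conjugate y"
  have conj_diff: "conjugate (a - b) = conjugate a - conjugate b" for a b :: 'k
    using conjugate_dist_add[of a "- b"] by (simp add: conjugate_neg)
  have u: "conjugate u = - u" by (simp add: u_def conj_diff)
  have "u \<noteq> 0" using y self_adjoint_real[of y] by (auto simp: u_def)
  then have nu: "norm u \<noteq> 0" by simp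
  define i where "i = u / of_real (norm u)"
  have "- (u * u) = of_real (norm u) * of_real (norm u)"
    using mult_conjugate[of u] by (simp add: u power2_eq_square)
  then have "u * u = - (of_real (norm u) * of_real (norm u))" by (metis minus_minus)
  then have ii: "i * i = - 1" using nu by (simp add: i_def)
  have ui: "u = of_real (norm u) * i" using nu by (simp add: i_def)
  have "conjugate u = of_real (norm u) * conjugate i"
    by (subst ui) (simp add: conjugate_dist_mul)
  then have "of_real (norm u) * conjugate i = of_real (norm u) * (- i)"
    using u ui by simp
  then have ci: "conjugate i = - i" using nu by (metis mult_left_cancel of_real_eq_0_iff)
  have "\<exists>a b. x = of_real a + of_real b * i" for x :: 'k
  proof -
    have "x + conjugate x \<in> range of_real"
      by (rule self_adjoint_real) (simp add: conjugate_dist_add add.commute)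
    then obtain a where a: "x + conjugate x = of_real a" by blast
    have "(x - conjugate x) * i \<in> range of_real"
      by (rule self_adjoint_real) (simp add: conjugate_dist_mul conj_diff ci algebra_simps)
    then obtain b where b: "(x - conjugate x) * i = of_real b" by blast
    have "x - conjugate x = - ((x - conjugate x) * i) * i" by (simp add: ii mult.assoc)
    also have "\<dots> = of_real (- b) * i" by (simp add: b)
    finally have d: "x - conjugate x = of_real (- b) * i" .
    have "2 * x = (x + conjugate x) + (x - conjugate x)" by simp
    also have "\<dots> = of_real a + of_real (- b) * i" by (simp only: a d)
    finally have "x = of_real (a / 2) + of_real (- b / 2) * i"
      by (simp add: field_simps)
    then show ?thesis by blast
  qed
  then show ?thesis using ii by blast
qed simp

section \<open>The exterior algebra of \<open>\<bbbF>\<^sup>n\<close>\<close>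

text \<open>
  A multivector is given by its coordinates with respect to the basis
  \<open>e\<^sub>I = e\<^sub>i\<^sub>1 \<and> \<dots> \<and> e\<^sub>i\<^sub>p\<close>, where \<open>I = {i\<^sub>1 < \<dots> < i\<^sub>p}\<close> ranges over
  the subsets of the (linearly ordered) index type of \<open>\<bbbF>\<^sup>n\<close>. The order only fixes the signs of
  these basis elements.
  The componentwise multiplication that the library puts on this type is never used.
\<close>

type_synonym ('k, 'n) vector = "('k, 'n) Finite_Cartesian_Product.vec"
type_synonym ('k, 'n) multivector = "('k, 'n set) Finite_Cartesian_Product.vec"

text \<open>\<open>e\<^sub>I \<and> e\<^sub>J = shuffle_sign I J *s e\<^sub>I\<^sub>\<union>\<^sub>J\<close> for disjoint \<open>I\<close>, \<open>J\<close>: count the inversions.\<close>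

definition shuffle_sign :: "'n::{finite,linorder} set \<Rightarrow> 'n set \<Rightarrow> 'k::comm_ring_1" where
  "shuffle_sign I J = (- 1) ^ card {(i, j). i \<in> I \<and> j \<in> J \<and> j < i}"

definition wedge ::
  "('k::comm_ring_1, 'n::{finite,linorder}) multivector \<Rightarrow> ('k, 'n) multivector \<Rightarrow> ('k, 'n) multivector"
  where "wedge a b = (\<chi> K. \<Sum>I\<in>Pow K. shuffle_sign I (K - I) * a $ I * b $ (K - I))"

definition of_scalar :: "'k::comm_ring_1 \<Rightarrow> ('k, 'n::finite) multivector" where
  "of_scalar \<kappa> = axis {} \<kappa>"

definition of_vector :: "('k::comm_ring_1, 'n) vector \<Rightarrow> ('k, 'n::finite) multivector" where
  "of_vector v = (\<Sum>i\<in>UNIV. axis {i} (v $ i))"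

fun wedges :: "('k::comm_ring_1, 'n::{finite,linorder}) vector list \<Rightarrow> ('k, 'n) multivector" where
  "wedges [] = of_scalar 1"
| "wedges (v # vs) = wedge (of_vector v) (wedges vs)"

definition is_blade :: "nat \<Rightarrow> ('k::comm_ring_1, 'n::{finite,linorder}) multivector \<Rightarrow> bool" where
  "is_blade p A \<longleftrightarrow>
     (if p = 0 then \<exists>\<kappa>. A = of_scalar \<kappa> else \<exists>vs. length vs = p \<and> A = wedges vs)"

text \<open>\<^const>\<open>vec.span\<close> is the span over the scalar field \<open>'k\<close> (whereas \<^const>\<open>span\<close> is the real span).\<close>

definition represents ::
  "('k::field, 'n::{finite,linorder}) multivector \<Rightarrow> ('k, 'n) vector set \<Rightarrow> bool" where
  "represents A V \<longleftrightarrow> A \<noteq> 0 \<and>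
     ((\<exists>\<kappa>. A = of_scalar \<kappa> \<and> V = {0}) \<or>
      (\<exists>vs. vs \<noteq> [] \<and> A = wedges vs \<and> V = vec.span (set vs)))"

text \<open>\<open>[A]\<close>; an unspecified set if \<open>A = 0\<close>.\<close>

definition blade_space ::
  "('k::field, 'n::{finite,linorder}) multivector \<Rightarrow> ('k, 'n) vector set" where
  "blade_space A = (THE V. represents A V)"

definition exterior_subalgebra ::
  "('k::field, 'n::{finite,linorder}) vector set \<Rightarrow> ('k, 'n) multivector set" where
  "exterior_subalgebra W = vec.span {wedges ws | ws. set ws \<subseteq> W}"

section \<open>Inner products\<close>

text \<open>For the real numbers this is a symmetric positive definite bilinear form.\<close>

definition inner_product :: "(('k::real_or_complex, 'n::finite) vector \<Rightarrow> ('k, 'n) vector \<Rightarrow> 'k) \<Rightarrow> bool" where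
  "inner_product g \<longleftrightarrow>
     (\<forall>x y z. g x (y + z) = g x y + g x z) \<and>
     (\<forall>c x y. g x (c *s y) = c * g x y) \<and>
     (\<forall>x y. g y x = conjugate (g x y)) \<and>
     (\<forall>x. x \<noteq> 0 \<longrightarrow> (\<exists>r>0. g x x = of_real r))"

definition gram_det ::
  "('a \<Rightarrow> 'a \<Rightarrow> 'k::comm_ring_1) \<Rightarrow> 'a list \<Rightarrow> 'a list \<Rightarrow> 'k" where
  "gram_det g vs ws =
     Determinant.det (Matrix.mat (length vs) (length ws) (\<lambda>(i, j). g (vs ! i) (ws ! j)))"

definition basis_list :: "'n::{finite,linorder} set \<Rightarrow> ('k::comm_ring_1, 'n) vector list" where
  "basis_list I = map (\<lambda>i. axis i 1) (sorted_list_of_set I)"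

text \<open>
  The sesquilinear extension of the determinant formula from the basis elements \<open>e\<^sub>I\<close>. Lemma
  \<open>ext_inner_wedges\<close> is the determinant formula for all products of vectors, and lemma
  \<open>ext_inner_wedges_orthogonal\<close> the orthogonality of distinct grades; grade zero is lemma
  \<open>ext_inner_of_scalar\<close>.
\<close>

definition ext_inner ::
  "(('k::real_or_complex, 'n::{finite,linorder}) vector \<Rightarrow> ('k, 'n) vector \<Rightarrow> 'k) \<Rightarrow>
   ('k, 'n) multivector \<Rightarrow> ('k, 'n) multivector \<Rightarrow> 'k" where
  "ext_inner g a b =
     (\<Sum>I\<in>UNIV. \<Sum>J\<in>UNIV. if card I = card J
        then conjugate (a $ I) * b $ J * gram_det g (basis_list I) (basis_list J) else 0)"

text \<open>\<^term>\<open>ext_inner g a a\<close> is a nonnegative real number; \<^const>\<open>norm\<close> makes it an element of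
  \<^typ>\<open>real\<close>.\<close>

definition ext_norm ::
  "(('k::real_or_complex, 'n::{finite,linorder}) vector \<Rightarrow> ('k, 'n) vector \<Rightarrow> 'k) \<Rightarrow> ('k, 'n) multivector \<Rightarrow> real"
  where "ext_norm g a = sqrt (norm (ext_inner g a a))"

definition contraction ::
  "(('k::real_or_complex, 'n::{finite,linorder}) vector \<Rightarrow> ('k, 'n) vector \<Rightarrow> 'k) \<Rightarrow>
   ('k, 'n) multivector \<Rightarrow> ('k, 'n) multivector \<Rightarrow> ('k, 'n) multivector" where
  "contraction g A B = (THE D. \<forall>C. ext_inner g C D = ext_inner g (wedge A C) B)"

definition ext_proj ::
  "(('k::real_or_complex, 'n::{finite,linorder}) vector \<Rightarrow> ('k, 'n) vector \<Rightarrow> 'k) \<Rightarrow>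
   ('k, 'n) vector set \<Rightarrow> ('k, 'n) multivector \<Rightarrow> ('k, 'n) multivector" where
  "ext_proj g W a = (THE b. b \<in> exterior_subalgebra W \<and>
     (\<forall>c\<in>exterior_subalgebra W. ext_inner g c (a - b) = 0))"

text \<open>The value does not depend on the choice of the blade representing \<open>V\<close>.\<close>

definition asym_angle ::
  "(('k::real_or_complex, 'n::{finite,linorder}) vector \<Rightarrow> ('k, 'n) vector \<Rightarrow> 'k) \<Rightarrow>
   ('k, 'n) vector set \<Rightarrow> ('k, 'n) vector set \<Rightarrow> real" where
  "asym_angle g V W = (THE \<theta>. \<forall>A. represents A V \<longrightarrow>
     \<theta> = arccos (ext_norm g (ext_proj g W A) / ext_norm g A))"

section \<open>Consistency of the definitions\<close>

text \<open>
  \<^const>\<open>wedge\<close> is associative with unit \<^term>\<open>of_scalar 1\<close>, and vectors square to zero.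
\<close>

lemma shuffle_sign_Un_left:
  "I \<inter> J = {} \<Longrightarrow> shuffle_sign (I \<union> J) M = shuffle_sign I M * shuffle_sign J M"
proof -
  assume "I \<inter> J = {}"
  moreover have "{(i, j). i \<in> I \<union> J \<and> j \<in> M \<and> j < i} =
      {(i, j). i \<in> I \<and> j \<in> M \<and> j < i} \<union> {(i, j). i \<in> J \<and> j \<in> M \<and> j < i}" by auto
  ultimately show ?thesis
    unfolding shuffle_sign_def by (subst power_add[symmetric], subst card_Un_disjoint[symmetric]) auto
qed

lemma shuffle_sign_Un_right:
  "I \<inter> J = {} \<Longrightarrow> shuffle_sign M (I \<union> J) = shuffle_sign M I * shuffle_sign M J"
proof -
  assume "I \<inter> J = {}"
  moreover have "{(i, j). i \<in> M \<and> j \<in> I \<union> J \<and> j < i} =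
      {(i, j). i \<in> M \<and> j \<in> I \<and> j < i} \<union> {(i, j). i \<in> M \<and> j \<in> J \<and> j < i}" by auto
  ultimately show ?thesis
    unfolding shuffle_sign_def by (subst power_add[symmetric], subst card_Un_disjoint[symmetric]) auto
qed

lemma shuffle_sign_empty [simp]: "shuffle_sign {} I = 1" "shuffle_sign I {} = 1"
  by (simp_all add: shuffle_sign_def)

lemma wedge_assoc: "wedge (wedge a b) c = wedge a (wedge b c)"
proof -
  have "wedge (wedge a b) c $ K = wedge a (wedge b c) $ K" for K
  proof -
    have "wedge (wedge a b) c $ K =
      (\<Sum>(L, I)\<in>Sigma (Pow K) Pow. shuffle_sign L (K - L) * (shuffle_sign I (L - I) * a $ I * b $ (L - I)) * c $ (K - L))"
      by (simp add: wedge_def sum_distrib_left sum_distrib_right sum.Sigma)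
    also have "\<dots> = (\<Sum>(I, J)\<in>Sigma (Pow K) (\<lambda>I. Pow (K - I)).
      shuffle_sign I (K - I) * a $ I * (shuffle_sign J (K - I - J) * b $ J * c $ (K - I - J)))"
    proof (rule sum.reindex_bij_witness[where i = "\<lambda>(I, J). (I \<union> J, I)" and j = "\<lambda>(L, I). (I, L - I)"], goal_cases)
      case (5 x)
      obtain L I where x: "x = (L, I)" by force
      from 5 x have "I \<subseteq> L" "L \<subseteq> K" by auto
      then have L: "L = I \<union> (L - I)" and K: "K - I = (L - I) \<union> (K - L)" and e: "K - I - (L - I) = K - L" by auto
      have 1: "shuffle_sign L (K - L) = (shuffle_sign I (K - L) * shuffle_sign (L - I) (K - L) :: 'a)"
        by (subst L, subst shuffle_sign_Un_left) auto
      have 2: "shuffle_sign I (K - I) = (shuffle_sign I (L - I) * shuffle_sign I (K - L) :: 'a)"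
        by (subst K, subst shuffle_sign_Un_right) auto
      show ?case by (simp add: x 1 2 e mult_ac)
    qed auto
    also have "\<dots> = wedge a (wedge b c) $ K"
      by (simp add: wedge_def sum_distrib_left sum_distrib_right sum.Sigma)
    finally show ?thesis .
  qed
  then show ?thesis by (simp add: vec_eq_iff)
qed

lemma wedge_of_scalar: "wedge (of_scalar \<kappa>) a = \<kappa> *s a" "wedge a (of_scalar \<kappa>) = \<kappa> *s a"
proof -
  have "wedge (of_scalar \<kappa>) a $ K = \<kappa> * a $ K" for K
  proof -
    have "wedge (of_scalar \<kappa>) a $ K = (\<Sum>I\<in>Pow K. if I = {} then \<kappa> * a $ K else 0)"
      unfolding wedge_def vec_lambda_beta
      by (rule sum.cong) (auto simp: of_scalar_def axis_def)
    then show ?thesis by simp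
  qed
  moreover have "wedge a (of_scalar \<kappa>) $ K = \<kappa> * a $ K" for K
  proof -
    have "wedge a (of_scalar \<kappa>) $ K = (\<Sum>I\<in>Pow K. if I = K then \<kappa> * a $ K else 0)"
      unfolding wedge_def vec_lambda_beta
      by (rule sum.cong) (auto simp: of_scalar_def axis_def)
    then show ?thesis by simp
  qed
  ultimately show "wedge (of_scalar \<kappa>) a = \<kappa> *s a" "wedge a (of_scalar \<kappa>) = \<kappa> *s a"
    by (simp_all add: vec_eq_iff)
qed

lemma wedges_append: "wedges (xs @ ys) = wedge (wedges xs) (wedges ys)"
  by (induction xs) (simp_all add: wedge_assoc wedge_of_scalar)

lemma of_vector_nth:
  "of_vector v $ I = (if is_singleton I then v $ the_elem I else 0)"
proof -
  have "of_vector v $ I = (\<Sum>i\<in>UNIV. if I = {i} then v $ i else 0)"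
    by (auto simp: of_vector_def axis_def intro!: sum.cong)
  also have "\<dots> = (if is_singleton I then v $ the_elem I else 0)"
    by (auto simp: is_singleton_def)
  finally show ?thesis .
qed

lemma wedge_of_vector_nth:
  "wedge (of_vector v) a $ K = (\<Sum>i\<in>K. shuffle_sign {i} (K - {i}) * v $ i * a $ (K - {i}))"
proof -
  have "wedge (of_vector v) a $ K =
      (\<Sum>I\<in>(\<lambda>i. {i}) ` K. shuffle_sign I (K - I) * of_vector v $ I * a $ (K - I))"
    unfolding wedge_def vec_lambda_beta
    by (rule sum.mono_neutral_right) (auto simp: of_vector_nth is_singleton_def)
  then show ?thesis by (simp add: sum.reindex of_vector_nth)
qed

lemma wedge_of_vector_self: "wedge (of_vector v) (of_vector v) = 0"
proof -
  have "wedge (of_vector v) (of_vector v) $ K = 0" for K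
  proof (cases "\<exists>i j. K = {i, j} \<and> i < j")
    case True
    then obtain i j where K: "K = {i, j}" "i < j" by blast
    then have d: "K - {i} = {j}" "K - {j} = {i}" "i \<noteq> j" by auto
    have e: "{(i', j'). i' \<in> {i} \<and> j' \<in> {j} \<and> j' < i'} = {}"
      "{(i', j'). i' \<in> {j} \<and> j' \<in> {i} \<and> j' < i'} = {(j, i)}"
      using K(2) by auto
    have s: "shuffle_sign {i} {j} = (1 :: 'a)" "shuffle_sign {j} {i} = (- 1 :: 'a)"
      unfolding shuffle_sign_def e by simp_all
    have "sum h K = h i + h j" for h :: "_ \<Rightarrow> 'a" using K d by simp
    then show ?thesis by (simp add: wedge_of_vector_nth d s of_vector_nth)
  next
    case False
    have "\<not> is_singleton (K - {i})" if "i \<in> K" for i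
    proof
      assume "is_singleton (K - {i})"
      then obtain j where "K - {i} = {j}" by (auto simp: is_singleton_def)
      with that have "K = {i, j}" "i \<noteq> j" by auto
      with False show False by (metis insert_commute linorder_neqE)
    qed
    then show ?thesis by (simp add: wedge_of_vector_nth of_vector_nth)
  qed
  then show ?thesis by (simp add: vec_eq_iff)
qed

lemma wedges_nth_eq_0: "card I \<noteq> length vs \<Longrightarrow> wedges vs $ I = 0"
proof (induction vs arbitrary: I)
  case Nil
  then show ?case by (auto simp: of_scalar_def axis_def)
next
  case (Cons v vs)
  have "wedges vs $ (I - {i}) = 0" if "i \<in> I" for i
    using Cons.prems that card_Suc_Diff1[of I i] by (intro Cons.IH) auto
  then show ?case by (simp add: wedge_of_vector_nth)
qed

text \<open>The universal property of the exterior powers, for alternating forms.\<close>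

definition alternating_form ::
  "nat \<Rightarrow> (('k::comm_ring_1, 'n::finite) vector list \<Rightarrow> 'k) \<Rightarrow> bool" where
  "alternating_form p f \<longleftrightarrow>
     (\<forall>xs ys c u v. length xs + length ys + 1 = p \<longrightarrow>
        f (xs @ (c *s u + v) # ys) = c * f (xs @ u # ys) + f (xs @ v # ys)) \<and>
     (\<forall>vs. length vs = p \<longrightarrow> \<not> distinct vs \<longrightarrow> f vs = 0)"

lemma alternating_form_linear:
  "alternating_form p f \<Longrightarrow> length xs + length ys + 1 = p \<Longrightarrow>
    f (xs @ (c *s u + v) # ys) = c * f (xs @ u # ys) + f (xs @ v # ys)"
  by (simp add: alternating_form_def)

lemma alternating_form_0:
  assumes "alternating_form p f" "length xs + length ys + 1 = p"
  shows "f (xs @ 0 # ys) = 0"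
  using alternating_form_linear[OF assms, of "- 1" 0 0] by simp

lemma alternating_form_sum:
  assumes f: "alternating_form p f" "length xs + length ys + 1 = p" and "finite S"
  shows "f (xs @ (\<Sum>i\<in>S. c i *s u i) # ys) = (\<Sum>i\<in>S. c i * f (xs @ u i # ys))"
  using \<open>finite S\<close>
  by (induction S) (simp_all add: alternating_form_0[OF f] alternating_form_linear[OF f])

lemma alternating_form_swap:
  assumes f: "alternating_form p f" "length xs + length ys + 2 = p"
  shows "f (xs @ u # v # ys) = - f (xs @ v # u # ys)"
proof -
  have nd: "f (xs @ w # w # ys) = 0" for w
    using f by (auto simp: alternating_form_def)
  have add1: "f (xs @ (u + v) # w # ys) = f (xs @ u # w # ys) + f (xs @ v # w # ys)" for w
    using alternating_form_linear[OF f(1), of xs "w # ys" 1 u v] f(2) by simp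
  have add2: "f (xs @ w # (u + v) # ys) = f (xs @ w # u # ys) + f (xs @ w # v # ys)" for w
    using alternating_form_linear[OF f(1), of "xs @ [w]" ys 1 u v] f(2) by simp
  have "0 = f (xs @ (u + v) # (u + v) # ys)" by (simp only: nd)
  also have "\<dots> = f (xs @ u # v # ys) + f (xs @ v # u # ys)"
    by (simp only: add1 add2) (simp add: nd)
  finally show ?thesis by (metis eq_neg_iff_add_eq_0)
qed

lemma alternating_form_insort:
  assumes "alternating_form p f" "sorted is" "i \<notin> set is" "distinct is" "length xs + length is + 1 = p"
  shows "f (xs @ h i # map h is) =
    (- 1) ^ card {j \<in> set is. j < i} * f (xs @ map h (insort i is))"
  using assms
proof (induction "is" arbitrary: xs)
  case (Cons k "is")
  show ?case
  proof (cases "i \<le> k")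
    case True
    then have e: "{j \<in> set (k # is). j < i} = {}" using Cons.prems by auto
    show ?thesis unfolding e using True by simp
  next
    case False
    then have eq: "{j \<in> set (k # is). j < i} = insert k {j \<in> set is. j < i}" by auto
    have "card {j \<in> set (k # is). j < i} = Suc (card {j \<in> set is. j < i})"
      unfolding eq by (subst card_insert_disjoint) (use Cons.prems in auto)
    moreover have "f (xs @ h i # h k # map h is) = - f ((xs @ [h k]) @ h i # map h is)"
      using alternating_form_swap[OF Cons.prems(1), of xs "map h is" "h i" "h k"] Cons.prems(5) by simp
    moreover have "f ((xs @ [h k]) @ h i # map h is) =
        (- 1) ^ card {j \<in> set is. j < i} * f ((xs @ [h k]) @ map h (insort i is))"
      by (rule Cons.IH) (use Cons.prems in auto)
    ultimately show ?thesis using False by simp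
  qed
qed simp

lemma alternating_form_insert:
  assumes "alternating_form p f" "card I + 1 = p" "i \<notin> I"
  shows "f (axis i 1 # basis_list I) = shuffle_sign {i} I * f (basis_list (insert i I))"
proof -
  have "{(i', j). i' \<in> {i} \<and> j \<in> I \<and> j < i'} = Pair i ` {j \<in> I. j < i}" by auto
  then have "shuffle_sign {i} I = ((- 1) ^ card {j \<in> I. j < i} :: 'a)"
    by (simp add: shuffle_sign_def card_image inj_on_def)
  moreover have "insort i (sorted_list_of_set I) = sorted_list_of_set (insert i I)"
    using assms by (simp add: sorted_list_of_set_insert)
  ultimately show ?thesis
    using alternating_form_insort[OF assms(1), of "sorted_list_of_set I" i "[]" "\<lambda>i. axis i 1"] assms
    by (simp add: basis_list_def)
qed

lemma alternating_form_eq_wedges: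
  assumes "alternating_form p f" "length vs = p"
  shows "f vs = (\<Sum>I | card I = p. wedges vs $ I * f (basis_list I))"
  using assms
proof (induction vs arbitrary: p f)
  case Nil
  then show ?case by (simp add: of_scalar_def axis_def basis_list_def)
next
  case (Cons v vs)
  let ?q = "length vs"
  have p: "p = Suc ?q" using Cons.prems by simp
  have "alternating_form ?q (\<lambda>us. f (v # us))"
    unfolding alternating_form_def
  proof (intro conjI allI impI)
    fix xs ys :: "('a, 'b) vector list" and c u w assume "length xs + length ys + 1 = ?q"
    then show "f (v # xs @ (c *s u + w) # ys) = c * f (v # xs @ u # ys) + f (v # xs @ w # ys)"
      using alternating_form_linear[OF Cons.prems(1), of "v # xs" ys c u w] p by simp
  next
    fix us :: "('a, 'b) vector list" assume "length us = ?q" "\<not> distinct us"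
    then show "f (v # us) = 0" using Cons.prems(1) p by (auto simp: alternating_form_def)
  qed
  from Cons.IH[OF this refl]
  have "f (v # vs) = (\<Sum>I | card I = ?q. wedges vs $ I * f (v # basis_list I))" .
  also have "\<dots> = (\<Sum>I | card I = ?q. \<Sum>i\<in>- I.
      wedges vs $ I * v $ i * shuffle_sign {i} I * f (basis_list (insert i I)))"
  proof (rule sum.cong[OF refl])
    fix I :: "'b set" assume "I \<in> {I. card I = ?q}"
    then have I: "card I = ?q" by simp
    have len: "length ([]::('a, 'b) vector list) + length (basis_list I :: ('a, 'b) vector list) + 1 = p"
      using I p by (simp add: basis_list_def)
    have "f (v # basis_list I) = (\<Sum>i\<in>UNIV. v $ i * f (axis i 1 # basis_list I))"
      using alternating_form_sum[OF Cons.prems(1) len, of UNIV "\<lambda>i. v $ i" "\<lambda>i. axis i 1"]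
      by (simp add: basis_expansion)
    also have "\<dots> = (\<Sum>i\<in>- I. v $ i * f (axis i 1 # basis_list I))"
    proof (rule sum.mono_neutral_right)
      show "\<forall>i\<in>UNIV - - I. v $ i * f (axis i 1 # basis_list I) = 0"
      proof
        fix i assume "i \<in> UNIV - - I"
        then have "\<not> distinct (axis i 1 # basis_list I :: ('a, 'b) vector list)"
          by (auto simp: basis_list_def)
        then have "f (axis i 1 # basis_list I) = 0"
          using Cons.prems(1) len by (auto simp: alternating_form_def)
        then show "v $ i * f (axis i 1 # basis_list I) = 0" by simp
      qed
    qed auto
    also have "\<dots> = (\<Sum>i\<in>- I. v $ i * (shuffle_sign {i} I * f (basis_list (insert i I))))"
      using alternating_form_insert[OF Cons.prems(1)] I p by (intro sum.cong) auto
    finally show "wedges vs $ I * f (v # basis_list I) =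
      (\<Sum>i\<in>- I. wedges vs $ I * v $ i * shuffle_sign {i} I * f (basis_list (insert i I)))"
      by (simp add: sum_distrib_left mult_ac)
  qed
  also have "\<dots> = (\<Sum>(I, i)\<in>Sigma {I. card I = ?q} (\<lambda>I. - I).
      wedges vs $ I * v $ i * shuffle_sign {i} I * f (basis_list (insert i I)))"
    by (simp add: sum.Sigma)
  also have "\<dots> = (\<Sum>(K, i)\<in>Sigma {K. card K = p} (\<lambda>K. K).
      shuffle_sign {i} (K - {i}) * v $ i * wedges vs $ (K - {i}) * f (basis_list K))"
    by (rule sum.reindex_bij_witness[where i = "\<lambda>(K, i). (K - {i}, i)" and j = "\<lambda>(I, i). (insert i I, i)"])
       (auto simp: p insert_absorb mult_ac card_Diff_singleton)
  also have "\<dots> = (\<Sum>K | card K = p. wedges (v # vs) $ K * f (basis_list K))"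
    by (simp add: sum.Sigma wedge_of_vector_nth sum_distrib_right)
  finally show ?case .
qed

text \<open>The inner product of the exterior algebra satisfies the determinant formula.\<close>

lemma gram_det_permutations:
  assumes "length ws = length vs"
  shows "gram_det g vs ws = (\<Sum>\<pi> | \<pi> permutes {0..<length vs}.
    signof \<pi> * (\<Prod>j<length vs. g (vs ! \<pi> j) (ws ! j)))"
proof -
  have "\<pi> j < length vs" if "\<pi> permutes {0..<length vs}" "j < length vs" for \<pi> j
    using permutes_in_image[OF that(1), of j] that(2) by simp
  then show ?thesis
    unfolding gram_det_def using assms
    by (subst det_col[of _ "length vs"]) (auto intro!: sum.cong prod.cong)
qed

lemma gram_det_alternating:
  fixes g :: "('k::real_or_complex, 'n::finite) vector \<Rightarrow> ('k, 'n) vector \<Rightarrow> 'k"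
  assumes "inner_product g"
  shows "alternating_form (length vs) (gram_det g vs)"
  unfolding alternating_form_def
proof (intro conjI allI impI)
  fix xs ys :: "('k, 'n) vector list" and c u v
  assume len: "length xs + length ys + 1 = length vs"
  let ?n = "length vs" and ?k = "length xs"
  have k: "?k < ?n" using len by simp
  have nth: "(xs @ w # ys) ! j = (xs @ 0 # ys) ! j" if "j \<noteq> ?k" for j w
    using that by (cases "j < ?k") (simp_all add: nth_append nth_Cons split: nat.split)
  have split: "(\<Prod>j<?n. g (vs ! \<pi> j) ((xs @ w # ys) ! j)) =
      g (vs ! \<pi> ?k) w * (\<Prod>j\<in>{..<?n} - {?k}. g (vs ! \<pi> j) ((xs @ 0 # ys) ! j))" for \<pi> w
  proof -
    have "(\<Prod>j\<in>{..<?n} - {?k}. g (vs ! \<pi> j) ((xs @ w # ys) ! j)) =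
        (\<Prod>j\<in>{..<?n} - {?k}. g (vs ! \<pi> j) ((xs @ 0 # ys) ! j))"
      by (rule prod.cong[OF refl]) (metis nth Diff_iff singletonI)
    then show ?thesis using k by (simp add: prod.remove[of "{..<?n}" ?k])
  qed
  have lin: "g x (c *s u + v) = c * g x u + g x v" for x
    using assms unfolding inner_product_def by metis
  show "gram_det g vs (xs @ (c *s u + v) # ys) =
      c * gram_det g vs (xs @ u # ys) + gram_det g vs (xs @ v # ys)"
    using len by (simp add: gram_det_permutations split lin sum_distrib_left
        distrib_left distrib_right sum.distrib mult_ac)
next
  fix ws :: "('k, 'n) vector list" assume len: "length ws = length vs" and "\<not> distinct ws"
  then obtain i j where ij: "i < length ws" "j < length ws" "i \<noteq> j" "ws ! i = ws ! j"
    by (auto simp: distinct_conv_nth)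
  show "gram_det g vs ws = 0"
    unfolding gram_det_def
    by (rule Determinant.det_identical_columns[where n = "length vs" and i = i and j = j])
       (use ij len in \<open>auto intro!: eq_vecI\<close>)
qed

lemma gram_det_conjugate:
  fixes g :: "('k::real_or_complex, 'n::finite) vector \<Rightarrow> ('k, 'n) vector \<Rightarrow> 'k"
  assumes g: "inner_product g" and len: "length vs = length ws"
  shows "conjugate (gram_det g vs ws) = gram_det g ws vs"
proof -
  interpret conj: comm_ring_hom "conjugate :: 'k \<Rightarrow> 'k"
  proof
    show "conjugate (1 :: 'k) = 1" using conjugate_of_real[of 1, where 'k = 'k] by simp
  qed (simp_all add: conjugate_dist_add conjugate_dist_mul)
  have herm: "conjugate (g x y) = g y x" for x y
    using g unfolding inner_product_def by metis
  let ?A = "Matrix.mat (length vs) (length ws) (\<lambda>(i, j). g (vs ! i) (ws ! j))"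
  have "gram_det g ws vs = Determinant.det (transpose_mat (map_mat conjugate ?A))"
    unfolding gram_det_def
    by (rule arg_cong[of _ _ Determinant.det], rule eq_matI) (auto simp: herm)
  also have "\<dots> = Determinant.det (map_mat conjugate ?A)"
    by (rule Determinant.det_transpose[of _ "length vs"]) (simp add: len)
  finally show ?thesis by (simp add: gram_det_def)
qed

lemma ext_inner_wedges:
  assumes g: "inner_product g" and len: "length vs = length ws"
  shows "ext_inner g (wedges vs) (wedges ws) = gram_det g vs ws"
proof -
  let ?p = "length ws"
  have bl: "length (basis_list I) = card I" for I :: "'b set" by (simp add: basis_list_def)
  have right: "gram_det g us ws = (\<Sum>J | card J = ?p. wedges ws $ J * gram_det g us (basis_list J))"
    if "length us = ?p" for us
    using alternating_form_eq_wedges[OF gram_det_alternating[OF g, of us]] that by simp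
  have left: "gram_det g vs (basis_list J) =
      (\<Sum>I | card I = ?p. conjugate (wedges vs $ I) * gram_det g (basis_list I) (basis_list J))"
    if "card J = ?p" for J
  proof -
    have "gram_det g (basis_list J) vs =
        (\<Sum>I | card I = ?p. wedges vs $ I * gram_det g (basis_list J) (basis_list I))"
      using alternating_form_eq_wedges[OF gram_det_alternating[OF g, of "basis_list J"], of vs] that len
      by (simp add: bl)
    then have "conjugate (gram_det g (basis_list J) vs) = (\<Sum>I | card I = ?p.
        conjugate (wedges vs $ I) * conjugate (gram_det g (basis_list J) (basis_list I)))"
      by (simp add: sum_conjugate conjugate_dist_mul)
    then show ?thesis
      using that len by (simp add: gram_det_conjugate[OF g] bl)
  qed
  have "gram_det g vs ws = (\<Sum>J | card J = ?p. \<Sum>I | card I = ?p.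
      conjugate (wedges vs $ I) * wedges ws $ J * gram_det g (basis_list I) (basis_list J))"
    using len by (simp add: right left sum_distrib_left mult_ac)
  also have "\<dots> = (\<Sum>I | card I = ?p. \<Sum>J | card J = ?p.
      conjugate (wedges vs $ I) * wedges ws $ J * gram_det g (basis_list I) (basis_list J))"
    by (rule sum.swap)
  also have "\<dots> = ext_inner g (wedges vs) (wedges ws)"
    unfolding ext_inner_def
    by (intro sum.mono_neutral_cong_left ballI)
       (auto simp: wedges_nth_eq_0 len intro!: sum.mono_neutral_cong_left cong: if_cong)
  finally show ?thesis by simp
qed

lemma ext_inner_wedges_orthogonal:
  "length vs \<noteq> length ws \<Longrightarrow> ext_inner g (wedges vs) (wedges ws) = 0"
  unfolding ext_inner_def
  by (intro sum.neutral ballI) (metis (no_types, opaque_lifting) conjugate_zero mult_zero_left mult_zero_right wedges_nth_eq_0)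

lemma ext_inner_of_scalar: "ext_inner g (of_scalar \<kappa>) (of_scalar \<mu>) = conjugate \<kappa> * \<mu>"
proof -
  have "(if card I = card J
        then conjugate (of_scalar \<kappa> $ I) * of_scalar \<mu> $ J * gram_det g (basis_list I) (basis_list J)
        else 0) =
      (if J = {} then if I = {} then conjugate \<kappa> * \<mu> else 0 else 0)" for I J
    by (auto simp: of_scalar_def axis_def gram_det_def basis_list_def)
  then show ?thesis by (simp add: ext_inner_def)
qed

end

theory Submission
  imports Defs
begin

text \<open>
  Let \<open>P\<close> be the orthogonal projection onto \<open>W = [B]\<close>. It induces an algebra homomorphism \<open>\<Lambda> P\<close> of
  the exterior algebra, which is self-adjoint and is the orthogonal projection onto \<open>\<Lambda> W\<close> (lemma
  \<open>ext_proj_eq\<close>). As \<open>B\<close> lies in \<open>\<Lambda> W\<close>, it follows that \<open>\<langle>A \<and> C, B\<rangle> = \<langle>\<Lambda> P A \<and> C, B\<rangle>\<close> for all \<open>C\<close>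
  (lemma \<open>wedge_inner_proj\<close>), so that \<open>A \<lrcorner> B = (\<Lambda> P A) \<lrcorner> B\<close>.

  The projection \<open>\<Lambda> P A\<close> of a blade is a blade of a subspace of \<open>W\<close>. Extending an orthonormal basis
  \<open>e\<^sub>1, \<dots>, e\<^sub>p\<close> of that subspace to one of \<open>W\<close> (lemma \<open>adapted_orthonormal_basis\<close>) gives
  \<open>\<Lambda> P A = a e\<^sub>1 \<and> \<dots> \<and> e\<^sub>p\<close> and \<open>B = b e\<^sub>1 \<and> \<dots> \<and> e\<^sub>q\<close>. A block triangular Gram determinant shows that
  \<open>A \<lrcorner> B\<close> is \<open>e\<^sub>p\<^sub>+\<^sub>1 \<and> \<dots> \<and> e\<^sub>q\<close> times a scalar of modulus \<open>\<bar>a\<bar> \<bar>b\<bar>\<close>, while \<open>\<parallel>B\<parallel> = \<bar>b\<bar>\<close> and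
  \<open>\<parallel>A\<parallel> cos \<Theta> = \<parallel>\<Lambda> P A\<parallel> = \<bar>a\<bar>\<close>. For \<open>p = q\<close> the complementary blade is \<open>1\<close>, and \<open>\<langle>A, B\<rangle> = \<langle>1, A \<lrcorner> B\<rangle>\<close>.

  The contraction, the projection, the space of a blade and the angle are all specified by definite
  descriptions, so existence and uniqueness have to be proved for each. Uniqueness of the contraction
  and of the projection rests on the inner product of multivectors being definite (lemma
  \<open>ext_inner_definite\<close>), that of \<open>[A]\<close> on \<open>[A] = {v. v \<and> A = 0}\<close> (lemma \<open>span_wedges\<close>), and that of
  the angle on the fact that blades with the same space are proportional (lemma
  \<open>represents_proportional\<close>).
\<close>

section \<open>Bilinearity and functoriality of the exterior algebra\<close>

lemma wedge_add_left: "wedge (a + b) c = wedge a c + wedge b c"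
  by (simp add: wedge_def vec_eq_iff distrib_left distrib_right sum.distrib)

lemma wedge_add_right: "wedge a (b + c) = wedge a b + wedge a c"
  by (simp add: wedge_def vec_eq_iff distrib_left sum.distrib)

lemma wedge_scale_left: "wedge (c *s a) b = c *s wedge a b"
  by (simp add: wedge_def vec_eq_iff sum_distrib_left mult_ac)

lemma wedge_scale_right: "wedge a (c *s b) = c *s wedge a b"
  by (simp add: wedge_def vec_eq_iff sum_distrib_left mult_ac)

lemma wedge_0 [simp]: "wedge 0 a = 0" "wedge a 0 = 0"
  by (simp_all add: wedge_def vec_eq_iff)

lemma wedge_uminus_left: "wedge (- a) b = - wedge a b"
  by (simp add: wedge_def vec_eq_iff sum_negf)

lemma of_vector_0: "of_vector 0 = 0"
  and of_vector_add: "of_vector (u + v) = of_vector u + of_vector v"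
  and of_vector_scale: "of_vector (c *s v) = c *s of_vector v"
  by (simp_all add: vec_eq_iff of_vector_nth)

lemma of_vector_anticommute:
  "wedge (of_vector u) (of_vector v) = - wedge (of_vector v) (of_vector u)"
proof -
  have "wedge (of_vector (u + v)) (of_vector (u + v)) = 0" by (rule wedge_of_vector_self)
  then show ?thesis
    by (simp add: of_vector_add wedge_add_left wedge_add_right wedge_of_vector_self add_eq_0_iff2)
qed

text \<open>Moving the last factor next to the first by transpositions only changes the sign.\<close>
lemma wedge_of_vector_wedges_of_vector:
  "wedge (of_vector v) (wedge (wedges xs) (of_vector v)) = 0"
proof (induction xs)
  case Nil
  then show ?case by (simp add: wedge_of_scalar wedge_of_vector_self)
next
  case (Cons x xs)
  have "wedge (of_vector v) (wedge (wedges (x # xs)) (of_vector v)) =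
      wedge (wedge (of_vector v) (of_vector x)) (wedge (wedges xs) (of_vector v))"
    by (simp add: wedge_assoc)
  also have "\<dots> = - wedge (of_vector x) (wedge (of_vector v) (wedge (wedges xs) (of_vector v)))"
    by (subst of_vector_anticommute) (simp add: wedge_uminus_left wedge_assoc)
  finally show ?case by (simp add: Cons.IH)
qed

lemma wedges_not_distinct: "\<not> distinct vs \<Longrightarrow> wedges vs = 0"
proof -
  assume "\<not> distinct vs"
  then obtain xs ys zs v where "vs = xs @ [v] @ ys @ [v] @ zs"
    using not_distinct_decomp by blast
  then have "wedges vs = wedge (wedges xs)
      (wedge (wedge (of_vector v) (wedge (wedges ys) (of_vector v))) (wedges zs))"
    by (simp add: wedges_append wedge_assoc)
  then show ?thesis by (simp add: wedge_of_vector_wedges_of_vector)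
qed

lemma wedges_linear:
  "wedges (xs @ (c *s u + v) # ys) = c *s wedges (xs @ u # ys) + wedges (xs @ v # ys)"
  by (simp add: wedges_append of_vector_add of_vector_scale wedge_add_left wedge_add_right
      wedge_scale_left wedge_scale_right)

text \<open>
  The algebra homomorphism \<open>\<Lambda> L\<close> that a linear map \<open>L\<close> induces, given by its values on the basis
  elements \<open>e\<^sub>I\<close>. If \<open>L\<close> is the orthogonal projection onto \<open>W\<close>, it is \<open>P\<^sub>W\<close> on
  multivectors (lemma \<open>ext_proj_eq\<close>).
\<close>
definition ext_map ::
  "(('k::field, 'n::{finite,linorder}) vector \<Rightarrow> ('k, 'n) vector) \<Rightarrow>
    ('k, 'n) multivector \<Rightarrow> ('k, 'n) multivector"
  where "ext_map L a = (\<Sum>I\<in>UNIV. a $ I *s wedges (map L (basis_list I)))"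

text \<open>
  Each coordinate of \<open>L v\<^sub>1 \<and> \<dots> \<and> L v\<^sub>p\<close> is an alternating form in the \<open>v\<^sub>i\<close>, hence determined by its
  values on the lists of basis vectors.
\<close>
lemma ext_map_wedges:
  assumes L: "Vector_Spaces.linear (*s) (*s) L"
  shows "ext_map L (wedges vs) = wedges (map L vs)"
proof -
  have "wedges (map L vs) $ K = ext_map L (wedges vs) $ K" for K
  proof -
    let ?f = "\<lambda>us. wedges (map L us) $ K"
    have "alternating_form (length vs) ?f"
      unfolding alternating_form_def
      by (auto simp: Vector_Spaces.linear_iff[THEN iffD1, OF L] wedges_linear distinct_map
          wedges_not_distinct)
    then have "?f vs = (\<Sum>I | card I = length vs. wedges vs $ I * ?f (basis_list I))"
      by (rule alternating_form_eq_wedges) simp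
    also have "\<dots> = (\<Sum>I\<in>UNIV. wedges vs $ I * ?f (basis_list I))"
      by (rule sum.mono_neutral_left) (auto simp: wedges_nth_eq_0)
    also have "\<dots> = ext_map L (wedges vs) $ K"
      by (simp add: ext_map_def)
    finally show ?thesis .
  qed
  then show ?thesis by (simp add: vec_eq_iff)
qed

lemma ext_map_linear: "ext_map L (c *s a + b) = c *s ext_map L a + ext_map L b"
  by (simp add: ext_map_def vec.scale_sum_right vec.scale_left_distrib sum.distrib)

lemma ext_map_0 [simp]: "ext_map L 0 = 0"
  by (simp add: ext_map_def)

lemma ext_map_scale: "ext_map L (c *s a) = c *s ext_map L a"
  using ext_map_linear[of L c a 0] by simp

lemma ext_map_diff: "ext_map L (a - b) = ext_map L a - ext_map L b"
  using ext_map_linear[of L "- 1" b a] by simp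

lemma wedges_basis_list:
  "wedges (basis_list I) = (axis I 1 :: ('k::comm_ring_1, 'n::{finite,linorder}) multivector)"
proof -
  have "wedges (map (\<lambda>i. axis i 1) is) = (axis (set is) 1 :: ('k, 'n) multivector)" if "sorted is" "distinct is"
    for "is" :: "'n list"
    using that
  proof (induction "is")
    case Nil
    then show ?case by (simp add: of_scalar_def)
  next
    case (Cons i "is")
    have v: "of_vector (axis i 1 :: ('k, 'n) vector) = axis {i} 1"
      by (auto simp: vec_eq_iff of_vector_nth axis_def is_singleton_def)
    have e: "{(i', j). i' \<in> {i} \<and> j \<in> set is \<and> j < i'} = {}" using Cons.prems by auto
    have s: "shuffle_sign {i} (set is) = (1 :: 'k)" unfolding shuffle_sign_def e by simp
    have "wedge (of_vector (axis i 1)) (axis (set is) 1) $ K = (axis (insert i (set is)) 1 $ K :: 'k)" for K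
    proof -
      have "wedge (of_vector (axis i 1)) (axis (set is) 1) $ K =
          (\<Sum>j\<in>K. if j = i then if K = insert i (set is) then 1 else 0 else (0 :: 'k))"
        unfolding wedge_of_vector_nth
      proof (rule sum.cong[OF refl])
        fix j assume "j \<in> K"
        then have "set is = K - {i} \<longleftrightarrow> K = insert i (set is)" if "j = i"
          using that Cons.prems by auto
        then show "shuffle_sign {j} (K - {j}) * axis i 1 $ j * axis (set is) 1 $ (K - {j}) =
            (if j = i then if K = insert i (set is) then 1 else 0 else (0 :: 'k))"
          using Cons.prems by (auto simp: axis_def s)
      qed
      also have "\<dots> = axis (insert i (set is)) 1 $ K"
        by (auto simp: axis_def)
      finally show ?thesis .
    qed
    then have "wedge (of_vector (axis i 1)) (axis (set is) 1) = (axis (insert i (set is)) 1 :: ('k, 'n) multivector)"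
      by (simp add: vec_eq_iff)
    then show ?case using Cons by simp
  qed
  from this[of "sorted_list_of_set I"] show ?thesis by (simp add: basis_list_def)
qed

text \<open>
  Products of vectors span the exterior algebra, so identities that are linear in a multivector
  only need to be verified on such products, where the determinant formula applies.
\<close>
lemma multivector_induct [case_names zero wedges linear]:
  fixes a :: "('k::field, 'n::{finite,linorder}) multivector"
  assumes "P 0" "\<And>vs. P (wedges vs)" "\<And>c a b. P a \<Longrightarrow> P b \<Longrightarrow> P (c *s a + b)"
  shows "P a"
proof -
  have "P (\<Sum>I\<in>S. a $ I *s wedges (basis_list I))" if "finite S" for S
    using that by (induction S) (simp_all add: assms)
  from this[of UNIV] show ?thesis
    by (simp add: wedges_basis_list basis_expansion)
qed

lemma ext_map_wedge:
  assumes L: "Vector_Spaces.linear (*s) (*s) L"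
  shows "ext_map L (wedge a b) = wedge (ext_map L a) (ext_map L b)"
proof (induction a rule: multivector_induct)
  case (wedges vs)
  show ?case
    by (induction b rule: multivector_induct)
      (simp_all add: ext_map_wedges[OF L] wedges_append[symmetric] wedge_add_right
        wedge_scale_right ext_map_linear)
qed (simp_all add: wedge_add_left wedge_scale_left ext_map_linear)

lemma ext_map_comp:
  assumes L: "Vector_Spaces.linear (*s) (*s) L" and M: "Vector_Spaces.linear (*s) (*s) M"
    and LM: "\<And>v. L (M v) = v"
  shows "ext_map L (ext_map M a) = a"
proof (induction a rule: multivector_induct)
  case (wedges vs)
  then show ?case by (simp add: ext_map_wedges[OF L] ext_map_wedges[OF M] LM o_def)
qed (simp_all add: ext_map_linear)

section \<open>Blades and the dimension of their spaces\<close>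

lemma wedge_of_vector_wedges_span:
  fixes vs :: "('k::field, 'n::{finite,linorder}) vector list"
  assumes "v \<in> vec.span (set vs)"
  shows "wedge (of_vector v) (wedges vs) = 0"
proof -
  have "vec.subspace {v. wedge (of_vector v) (wedges vs) = 0}"
    by (simp add: vec.subspace_def of_vector_0 of_vector_add of_vector_scale wedge_add_left wedge_scale_left)
  moreover have "set vs \<subseteq> {v. wedge (of_vector v) (wedges vs) = 0}"
  proof
    fix v assume "v \<in> set vs"
    then have "wedges (v # vs) = 0" by (intro wedges_not_distinct) simp
    then show "v \<in> {v. wedge (of_vector v) (wedges vs) = 0}" by simp
  qed
  ultimately have "vec.span (set vs) \<subseteq> {v. wedge (of_vector v) (wedges vs) = 0}"
    by (intro vec.span_minimal)
  then show ?thesis using assms by auto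
qed

text \<open>
  Each factor of a nonzero product lies outside the span of the later ones, so the factors are
  independent.
\<close>
lemma length_eq_dim_span:
  fixes vs :: "('k::field, 'n::{finite,linorder}) vector list"
  assumes "wedges vs \<noteq> 0"
  shows "length vs = vec.dim (vec.span (set vs))"
proof -
  have "vec.independent (set vs)" using assms
  proof (induction vs)
    case (Cons v vs)
    then have "wedges vs \<noteq> 0" "v \<notin> vec.span (set vs)"
      using wedge_of_vector_wedges_span[of v vs] by auto
    moreover from this have "v \<notin> set vs" using vec.span_base by blast
    ultimately show ?case using Cons.IH by (simp add: vec.independent_insert)
  qed (simp add: vec.independent_empty)
  moreover have "distinct vs" using assms wedges_not_distinct by blast
  ultimately show ?thesis by (metis vec.dim_span_eq_card_independent distinct_card)
qed

text \<open>
  Scalars are multiples of the empty product, whose span is \<open>{0}\<close>. This removes the distinction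
  between grade zero and the other grades.
\<close>
lemma representsE:
  fixes A :: "('k::field, 'n::{finite,linorder}) multivector"
  assumes "represents A V"
  obtains \<kappa> vs where "\<kappa> \<noteq> 0" "wedges vs \<noteq> 0" "A = \<kappa> *s wedges vs" "V = vec.span (set vs)"
proof -
  from assms consider \<kappa> where "A = of_scalar \<kappa>" "V = {0}"
    | vs where "A = wedges vs" "V = vec.span (set vs)"
    unfolding represents_def by blast
  then show thesis
  proof cases
    case 1
    have "A = \<kappa> *s wedges []" by (simp add: 1 of_scalar_def vec_eq_iff axis_def)
    then show thesis using assms 1 by (intro that[of \<kappa> "[]"]) (auto simp: represents_def)
  next
    case 2
    then show thesis using assms by (intro that[of 1 vs]) (auto simp: represents_def)
  qed
qed

lemma is_bladeE:
  fixes A :: "('k::field, 'n::{finite,linorder}) multivector"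
  assumes "is_blade p A" "A \<noteq> 0"
  obtains V where "represents A V" "vec.dim V = p"
proof (cases "p = 0")
  case True
  have "vec.dim {0 :: ('k, 'n) vector} = 0"
    using vec.dim_span_eq_card_independent[OF vec.independent_empty] by simp
  then show thesis using True assms that[of "{0}"] by (auto simp: is_blade_def represents_def)
next
  case False
  then obtain vs where vs: "length vs = p" "A = wedges vs" using assms by (auto simp: is_blade_def)
  then have "vs \<noteq> []" using False by auto
  then have "represents A (vec.span (set vs))" using vs assms(2) unfolding represents_def by blast
  moreover have "vec.dim (vec.span (set vs)) = p"
    using length_eq_dim_span[of vs] vs assms(2) by simp
  ultimately show thesis by (rule that)
qed

section \<open>Orthonormal systems and orthogonal projections\<close>

lemma conjugate_1 [simp]: "conjugate (1 :: 'k::real_or_complex) = 1"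
  using conjugate_of_real[of 1] by simp

lemma norm_conjugate [simp]: "norm (conjugate x) = norm (x :: 'k::real_or_complex)"
proof (cases "x = 0")
  case False
  have "norm x * norm (conjugate x) = norm x * norm x"
    using arg_cong[OF mult_conjugate[of x], of norm]
    by (simp only: norm_mult norm_of_real power2_eq_square abs_mult_self_eq abs_mult abs_norm_cancel)
  then show ?thesis using False by simp
qed simp

locale exterior_inner_product =
  fixes g :: "('k::real_or_complex, 'n::{finite,linorder}) vector \<Rightarrow> ('k, 'n) vector \<Rightarrow> 'k"
  assumes inner_product: "inner_product g"
begin

lemma
  shows add_right: "g x (y + z) = g x y + g x z"
    and scale_right: "g x (c *s y) = c * g x y"
    and hermitian: "g y x = conjugate (g x y)"
    and positive: "x \<noteq> 0 \<Longrightarrow> \<exists>r>0. g x x = of_real r"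
  using inner_product unfolding inner_product_def by metis+

lemma scale_left: "g (c *s x) y = conjugate c * g x y"
  by (subst hermitian) (simp add: scale_right conjugate_dist_mul hermitian[symmetric])

lemma zero_right [simp]: "g x 0 = 0" and diff_right: "g x (y - z) = g x y - g x z"
  using scale_right[of x 0 0] add_right[of x "y - z" z] by simp_all

lemma sum_right: "g x (\<Sum>i\<in>S. f i) = (\<Sum>i\<in>S. g x (f i))"
  by (induction S rule: infinite_finite_induct) (simp_all add: add_right)

lemma orthogonal_span:
  assumes "w \<in> vec.span S" "\<And>s. s \<in> S \<Longrightarrow> g x s = 0"
  shows "g x w = 0"
proof -
  have "vec.subspace {y. g x y = 0}"
    by (simp add: vec.subspace_def add_right scale_right)
  then have "vec.span S \<subseteq> {y. g x y = 0}"
    using assms(2) by (intro vec.span_minimal) auto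
  then show ?thesis using assms(1) by auto
qed

lemma orthogonal_sym: "g x y = 0 \<Longrightarrow> g y x = 0"
  by (subst hermitian) simp

lemma eq_0_iff: "g x x = 0 \<longleftrightarrow> x = 0"
proof
  assume "g x x = 0"
  then show "x = 0" using positive[of x] by (metis less_irrefl of_real_eq_0_iff)
qed simp

text \<open>
  Orthonormal systems are lists rather than sets since \<^const>\<open>wedges\<close> depends on the order of its
  factors.
\<close>
definition orthonormal :: "('k, 'n) vector list \<Rightarrow> bool" where
  "orthonormal es \<longleftrightarrow> distinct es \<and> (\<forall>x\<in>set es. \<forall>y\<in>set es. g x y = (if x = y then 1 else 0))"

text \<open>The orthogonal projection onto \<open>span es\<close> if \<open>es\<close> is orthonormal.\<close>
definition proj :: "('k, 'n) vector list \<Rightarrow> ('k, 'n) vector \<Rightarrow> ('k, 'n) vector" where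
  "proj es v = (\<Sum>e\<in>set es. g e v *s e)"

lemma proj_linear: "Vector_Spaces.linear (*s) (*s) (proj es)"
  by (simp add: Vector_Spaces.linear_iff proj_def add_right scale_right vec.vector_space_axioms
      vec.scale_left_distrib sum.distrib vec.scale_sum_right)

lemma proj_in_span: "proj es v \<in> vec.span (set es)"
  unfolding proj_def by (intro vec.span_sum vec.span_scale vec.span_base)

lemma proj_inner:
  assumes "orthonormal es" and "w \<in> vec.span (set es)"
  shows "g w (proj es v) = g w v"
proof -
  have "g (v - proj es v) w = 0"
  proof (rule orthogonal_span[OF assms(2)])
    fix e assume e: "e \<in> set es"
    have "g e (proj es v) = (\<Sum>x\<in>set es. if x = e then g x v else 0)"
      unfolding proj_def sum_right scale_right
      using assms(1) e by (intro sum.cong) (auto simp: orthonormal_def)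
    also have "\<dots> = g e v" using e by simp
    finally have "g e (v - proj es v) = 0" by (simp add: diff_right)
    then show "g (v - proj es v) e = 0" by (rule orthogonal_sym)
  qed
  then have "g w (v - proj es v) = 0" by (rule orthogonal_sym)
  then show ?thesis by (simp add: diff_right)
qed

text \<open>The difference \<open>v - proj es v\<close> is orthogonal to the span and lies in it.\<close>
lemma proj_id:
  assumes "orthonormal es" and "v \<in> vec.span (set es)"
  shows "proj es v = v"
proof -
  have "v - proj es v \<in> vec.span (set es)"
    by (intro vec.span_diff assms(2) proj_in_span)
  then have "g (v - proj es v) (v - proj es v) = 0"
    using proj_inner[OF assms(1)] by (simp add: diff_right)
  then show ?thesis by (simp add: eq_0_iff)
qed

lemma proj_symmetric:
  assumes "orthonormal es"
  shows "g (proj es u) v = g u (proj es v)"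
proof -
  have "g (proj es u) v = g (proj es u) (proj es v)"
    using proj_inner[OF assms proj_in_span] by simp
  also have "\<dots> = conjugate (g (proj es v) (proj es u))" by (rule hermitian)
  also have "\<dots> = conjugate (g (proj es v) u)" by (simp add: proj_inner[OF assms proj_in_span])
  also have "\<dots> = g u (proj es v)" by (simp only: hermitian[symmetric])
  finally show ?thesis .
qed

lemma orthonormal_independent: "orthonormal es \<Longrightarrow> vec.independent (set es)"
proof (induction es)
  case (Cons e es)
  have "e \<notin> vec.span (set es)"
  proof
    assume "e \<in> vec.span (set es)"
    then have "g e e = 0"
      by (rule orthogonal_span) (use Cons.prems in \<open>auto simp: orthonormal_def\<close>)
    then show False using Cons.prems by (simp add: orthonormal_def)
  qed
  moreover have "orthonormal es" using Cons.prems by (simp add: orthonormal_def)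
  ultimately show ?case using Cons.IH Cons.prems
    by (simp add: vec.independent_insert orthonormal_def)
qed (simp add: vec.independent_empty)

lemma orthonormal_length: "orthonormal es \<Longrightarrow> length es = vec.dim (vec.span (set es))"
  using vec.dim_span_eq_card_independent[OF orthonormal_independent[of es]]
  by (simp add: orthonormal_def distinct_card)

text \<open>Gram-Schmidt: normalise the component of a missing vector orthogonal to \<open>es\<close>, and append it.\<close>
lemma orthonormal_extend:
  assumes W: "vec.subspace W"
  shows "orthonormal es \<Longrightarrow> set es \<subseteq> W \<Longrightarrow>
    \<exists>fs. orthonormal (es @ fs) \<and> vec.span (set (es @ fs)) = W"
proof (induction "vec.dim W - length es" arbitrary: es rule: less_induct)
  case less
  have sub: "vec.span (set es) \<subseteq> W" using less.prems W by (simp add: vec.span_minimal)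
  show ?case
  proof (cases "vec.span (set es) = W")
    case True
    then show ?thesis using less.prems by (intro exI[of _ "[]"]) simp
  next
    case False
    with sub obtain w where w: "w \<in> W" "w \<notin> vec.span (set es)" by blast
    define u where "u = w - proj es w"
    have uW: "u \<in> W" unfolding u_def using w(1) proj_in_span[of es w] sub W
      by (intro vec.subspace_diff) auto
    have "u \<noteq> 0" using w(2) proj_in_span[of es w] by (auto simp: u_def)
    then obtain r where r: "r > 0" "g u u = of_real r" using positive by blast
    define e where "e = of_real (1 / sqrt r) *s u"
    have "g e e = of_real (1 / sqrt r * (1 / sqrt r) * r)"
      by (simp only: e_def scale_left scale_right r(2) conjugate_of_real of_real_mult mult.assoc)
    also have "1 / sqrt r * (1 / sqrt r) * r = 1" using r(1) by (simp add: field_simps)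
    finally have ee: "g e e = 1" by simp
    have xe: "g x e = 0" if "x \<in> set es" for x
      using proj_inner[OF less.prems(1) vec.span_base[OF that]]
      by (simp add: e_def scale_right u_def diff_right)
    have ex: "g e x = 0" if "x \<in> set es" for x using orthogonal_sym[OF xe[OF that]] .
    have "e \<notin> set es" using ee xe by auto
    then have on: "orthonormal (es @ [e])"
      using less.prems(1) ee xe ex by (auto simp: orthonormal_def)
    have eW: "set (es @ [e]) \<subseteq> W"
      using less.prems(2) uW W by (auto simp: e_def vec.subspace_scale)
    then have "vec.span (set (es @ [e])) \<subseteq> W" using W by (simp add: vec.span_minimal)
    then have "length (es @ [e]) \<le> vec.dim W"
      using orthonormal_length[OF on] vec.dim_subset by metis
    then have "vec.dim W - length (es @ [e]) < vec.dim W - length es" by simp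
    from less.hyps[OF this on eW] obtain fs where
      "orthonormal ((es @ [e]) @ fs)" "vec.span (set ((es @ [e]) @ fs)) = W" by blast
    then show ?thesis by (intro exI[of _ "e # fs"]) simp
  qed
qed

lemma orthonormal_basis:
  assumes "vec.subspace W"
  obtains es where "orthonormal es" "vec.span (set es) = W"
  using orthonormal_extend[OF assms, of "[]"] by (auto simp: orthonormal_def)

end

section \<open>The inner product of multivectors is definite\<close>

lemma ext_inner_linear_right:
  "ext_inner g a (c *s b + d) = c * ext_inner g a b + ext_inner g a d"
  by (auto simp: ext_inner_def sum_distrib_left sum.distrib[symmetric] algebra_simps intro!: sum.cong)

lemma ext_inner_linear_left:
  "ext_inner g (c *s a + b) d = conjugate c * ext_inner g a d + ext_inner g b d"
  by (auto simp: ext_inner_def sum_distrib_left sum.distrib[symmetric] algebra_simps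
      conjugate_dist_add conjugate_dist_mul intro!: sum.cong)

lemma ext_inner_0 [simp]: "ext_inner g a 0 = 0" "ext_inner g 0 a = 0"
  by (simp_all add: ext_inner_def cong: if_cong)

lemma ext_inner_scale_right: "ext_inner g a (c *s b) = c * ext_inner g a b"
  using ext_inner_linear_right[of g a c b 0] by simp

lemma ext_inner_scale_left: "ext_inner g (c *s a) b = conjugate c * ext_inner g a b"
  using ext_inner_linear_left[of g c a 0 b] by simp

lemma ext_inner_diff_left: "ext_inner g (a - b) d = ext_inner g a d - ext_inner g b d"
  using ext_inner_linear_left[of g "- 1" b a d] by (simp add: conjugate_neg)

lemma ext_inner_diff_right: "ext_inner g a (b - d) = ext_inner g a b - ext_inner g a d"
  using ext_inner_linear_right[of g a "- 1" d b] by simp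

lemma ext_inner_sum_right: "ext_inner g a (\<Sum>i\<in>S. c i *s b i) = (\<Sum>i\<in>S. c i * ext_inner g a (b i))"
  by (induction S rule: infinite_finite_induct) (simp_all add: ext_inner_linear_right)

lemma ext_inner_sum_left:
  "ext_inner g (\<Sum>i\<in>S. c i *s a i) b = (\<Sum>i\<in>S. conjugate (c i) * ext_inner g (a i) b)"
  by (induction S rule: infinite_finite_induct) (simp_all add: ext_inner_linear_left)

context exterior_inner_product
begin

text \<open>An orthonormal basis of the whole space, indexed like the coordinates.\<close>
lemma orthonormal_frame:
  obtains f :: "'n \<Rightarrow> ('k, 'n) vector"
  where "\<And>i j. g (f i) (f j) = (if i = j then 1 else 0)"
    and "\<And>v. (\<Sum>i\<in>UNIV. g (f i) v *s f i) = v"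
proof -
  obtain es where es: "orthonormal es" "vec.span (set es) = UNIV"
    using orthonormal_basis[OF vec.subspace_UNIV] .
  have "length es = CARD('n)"
    using orthonormal_length[OF es(1)] unfolding es(2) vec_dim_card .
  then have "card (set es) = CARD('n)"
    using es(1) by (simp add: orthonormal_def distinct_card)
  then obtain f where f: "bij_betw f (UNIV :: 'n set) (set es)"
    using finite_same_card_bij[of "UNIV :: 'n set" "set es"] by auto
  have inj: "f i = f j \<longleftrightarrow> i = j" for i j
    using f by (auto simp: bij_betw_def inj_on_def)
  have mem: "f i \<in> set es" for i using f by (auto simp: bij_betw_def)
  have "(\<Sum>i\<in>UNIV. g (f i) v *s f i) = proj es v" for v
    unfolding proj_def using sum.reindex_bij_betw[OF f, of "\<lambda>e. g e v *s e"] by simp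
  then have "(\<Sum>i\<in>UNIV. g (f i) v *s f i) = v" for v
    using proj_id[OF es(1)] es(2) by simp
  moreover have "g (f i) (f j) = (if i = j then 1 else 0)" for i j
    using es(1) mem inj by (simp add: orthonormal_def)
  ultimately show thesis using that by blast
qed

text \<open>
  For \<open>I \<noteq> J\<close> of equal size, some \<open>x \<in> J - I\<close> gives a zero column of the Gram matrix.
\<close>
lemma gram_det_orthonormal_frame:
  fixes f :: "'n \<Rightarrow> ('k, 'n) vector"
  assumes f: "\<And>i j. g (f i) (f j) = (if i = j then 1 else 0)" and c: "card I = card J"
  shows "gram_det g (map f (sorted_list_of_set I)) (map f (sorted_list_of_set J)) =
    (if I = J then 1 else 0)"
proof (cases "I = J")
  case True
  have "Matrix.mat (card J) (card J)
      (\<lambda>(i, j). g (map f (sorted_list_of_set J) ! i) (map f (sorted_list_of_set J) ! j)) =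
      1\<^sub>m (card J)"
    by (rule eq_matI) (auto simp: f nth_eq_iff_index_eq)
  then show ?thesis using True by (simp add: gram_det_def)
next
  case False
  have "\<not> J \<subseteq> I" using False c card_subset_eq[of I J] by auto
  then obtain x where x: "x \<in> J" "x \<notin> I" by blast
  then obtain j where j: "j < card J" "sorted_list_of_set J ! j = x"
    by (metis finite in_set_conv_nth length_sorted_list_of_set set_sorted_list_of_set)
  have 0: "(\<Prod>j<card I. g (map f (sorted_list_of_set I) ! \<pi> j) (map f (sorted_list_of_set J) ! j)) = 0"
    if \<pi>: "\<pi> permutes {0..<card I}" for \<pi>
  proof (rule prod_zero)
    have "\<pi> j < card I" using permutes_in_image[OF \<pi>, of j] j c by simp
    moreover from this have "sorted_list_of_set I ! \<pi> j \<in> I"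
      by (metis finite nth_mem length_sorted_list_of_set set_sorted_list_of_set)
    ultimately show "\<exists>j\<in>{..<card I}. g (map f (sorted_list_of_set I) ! \<pi> j) (map f (sorted_list_of_set J) ! j) = 0"
      using j c x by (intro bexI[of _ j]) (auto simp: f)
  qed simp
  have "gram_det g (map f (sorted_list_of_set I)) (map f (sorted_list_of_set J)) = 0"
    by (subst gram_det_permutations) (use 0 c in \<open>auto intro!: sum.neutral simp del: prod_zero_iff\<close>)
  then show ?thesis using False by simp
qed

text \<open>
  The linear map \<open>L\<close> that takes the standard basis to an orthonormal basis of \<open>g\<close> induces a
  surjection \<open>\<Lambda> L\<close> taking the basis elements \<open>e\<^sub>I\<close> to an orthonormal system. In the coordinates
  obtained in this way, the inner product of multivectors is the standard one.
\<close>
lemma ext_inner_definite: "\<exists>r\<ge>0. ext_inner g a a = of_real r \<and> (a \<noteq> 0 \<longrightarrow> r > 0)"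
proof -
  obtain f :: "'n \<Rightarrow> ('k, 'n) vector"
    where f: "\<And>i j. g (f i) (f j) = (if i = j then 1 else 0)"
      and f_expand: "\<And>v. (\<Sum>i\<in>UNIV. g (f i) v *s f i) = v"
    using orthonormal_frame by metis
  define L where "L x = (\<Sum>i\<in>UNIV. x $ i *s f i)" for x :: "('k, 'n) vector"
  define M where "M v = (\<chi> i. g (f i) v)" for v
  have L: "Vector_Spaces.linear (*s) (*s) L"
    by (simp add: Vector_Spaces.linear_iff L_def vec.vector_space_axioms
        vec.scale_left_distrib sum.distrib vec.scale_sum_right)
  have M: "Vector_Spaces.linear (*s) (*s) M"
    by (simp add: Vector_Spaces.linear_iff M_def vec.vector_space_axioms vec_eq_iff add_right scale_right)
  have LM: "L (M v) = v" for v by (simp add: L_def M_def f_expand)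
  define y where "y = ext_map M a"
  have a: "a = ext_map L y" unfolding y_def using ext_map_comp[OF L M LM] by simp
  have "L (axis i 1) = f i" for i
  proof -
    have "L (axis i 1) = (\<Sum>j\<in>UNIV. if j = i then f j else 0)"
      unfolding L_def by (rule sum.cong) (auto simp: axis_def)
    then show ?thesis by simp
  qed
  then have bl: "map L (basis_list I) = map f (sorted_list_of_set I)" for I
    by (simp add: basis_list_def)
  let ?F = "\<lambda>I. wedges (map f (sorted_list_of_set I))"
  have F: "ext_inner g (?F I) (?F J) = (if I = J then 1 else 0)" for I J
  proof (cases "card I = card J")
    case True
    then show ?thesis
      by (simp add: ext_inner_wedges[OF inner_product] gram_det_orthonormal_frame[OF f])
  next
    case False
    then show ?thesis by (auto simp: ext_inner_wedges_orthogonal)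
  qed
  have a': "a = (\<Sum>I\<in>UNIV. y $ I *s ?F I)" by (simp add: a ext_map_def bl)
  have Fa: "ext_inner g (?F I) a = y $ I" for I
    unfolding a' ext_inner_sum_right F by (simp add: if_distrib cong: if_cong)
  have "ext_inner g a a = (\<Sum>I\<in>UNIV. conjugate (y $ I) * ext_inner g (?F I) a)"
    by (subst a', subst ext_inner_sum_left) (rule refl)
  also have "\<dots> = (\<Sum>I\<in>UNIV. conjugate (y $ I) * y $ I)"
    by (simp only: Fa)
  also have "\<dots> = of_real (\<Sum>I\<in>UNIV. (norm (y $ I))\<^sup>2)"
    by (simp add: mult.commute[of "conjugate _"] mult_conjugate)
  finally have E: "ext_inner g a a = of_real (\<Sum>I\<in>UNIV. (norm (y $ I))\<^sup>2)" .
  have "(\<Sum>I\<in>UNIV. (norm (y $ I))\<^sup>2) > 0" if "a \<noteq> 0"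
  proof -
    have "y \<noteq> 0" using that a by auto
    then obtain I where "y $ I \<noteq> 0" by (auto simp: vec_eq_iff)
    then show ?thesis by (intro sum_pos2[of _ I]) auto
  qed
  with E show ?thesis by (intro exI[of _ "\<Sum>I\<in>UNIV. (norm (y $ I))\<^sup>2"]) (auto intro: sum_nonneg)
qed

lemma ext_norm_0 [simp]: "ext_norm g 0 = 0"
  by (simp add: ext_norm_def)

lemma ext_norm_nonneg [simp]: "ext_norm g a \<ge> 0"
  by (simp add: ext_norm_def)

lemma ext_inner_self: "ext_inner g a a = of_real ((ext_norm g a)\<^sup>2)"
  using ext_inner_definite[of a] by (auto simp: ext_norm_def)

lemma ext_norm_eq_0_iff [simp]: "ext_norm g a = 0 \<longleftrightarrow> a = 0"
  using ext_inner_definite[of a] by (auto simp: ext_norm_def)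

lemma ext_norm_scale: "ext_norm g (c *s a) = norm c * ext_norm g a"
  by (simp add: ext_norm_def ext_inner_scale_left ext_inner_scale_right norm_mult real_sqrt_mult)

lemma ext_inner_eqI:
  assumes "\<And>c. ext_inner g c a = ext_inner g c b"
  shows "a = b"
proof -
  have "ext_inner g (a - b) (a - b) = 0" by (simp add: ext_inner_diff_right assms)
  then show ?thesis by (simp add: ext_inner_self)
qed

lemma ext_inner_eqI_wedges:
  assumes "\<And>cs. ext_inner g (wedges cs) a = ext_inner g (wedges cs) b"
  shows "a = b"
proof (rule ext_inner_eqI)
  show "ext_inner g c a = ext_inner g c b" for c
    by (induction c rule: multivector_induct) (simp_all add: assms ext_inner_linear_left)
qed

section \<open>Gram determinants and orthonormal systems\<close>

text \<open>The Gram matrix is block triangular.\<close>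
lemma gram_det_block:
  assumes len: "length xs = length us" "length cs = length ws"
    and orth: "\<And>x w. x \<in> set xs \<Longrightarrow> w \<in> set ws \<Longrightarrow> g x w = 0"
  shows "gram_det g (xs @ cs) (us @ ws) = gram_det g xs us * gram_det g cs ws"
proof -
  let ?M = "\<lambda>vs ws. Matrix.mat (length vs) (length ws) (\<lambda>(i, j). g (vs ! i) (ws ! j))"
  let ?B = "four_block_mat (?M xs us) (0\<^sub>m (length us) (length ws)) (?M cs us) (?M cs ws)"
  have block: "?M (xs @ cs) (us @ ws) = ?B"
    by (rule eq_matI) (auto simp: len nth_append orth)
  have "Determinant.det ?B = Determinant.det (?M xs us) * Determinant.det (?M cs ws)"
    by (rule det_four_block_mat_upper_right_zero[OF _ refl])
       (rule carrier_matI; simp only: dim_row_mat dim_col_mat len)+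
  then show ?thesis unfolding gram_det_def block .
qed

lemma gram_det_orthonormal:
  assumes "orthonormal es"
  shows "gram_det g es es = 1"
proof -
  have "Matrix.mat (length es) (length es) (\<lambda>(i, j). g (es ! i) (es ! j)) = 1\<^sub>m (length es)"
    using assms by (intro eq_matI) (auto simp: orthonormal_def nth_eq_iff_index_eq)
  then show ?thesis by (simp add: gram_det_def)
qed

lemma ext_norm_wedges_orthonormal:
  assumes "orthonormal es"
  shows "ext_norm g (wedges es) = 1"
  using assms by (simp add: ext_norm_def ext_inner_wedges[OF inner_product] gram_det_orthonormal)

text \<open>
  By nondegeneracy it suffices to compare inner products with an arbitrary \<open>c\<^sub>1 \<and> \<dots> \<and> c\<^sub>m\<close>. Expanding
  the \<open>u\<^sub>j\<close> in the orthonormal basis factors the Gram matrix \<open>(\<langle>c\<^sub>i, u\<^sub>j\<rangle>)\<close> as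
  \<open>(\<langle>c\<^sub>i, e\<^sub>k\<rangle>) (\<langle>e\<^sub>k, u\<^sub>j\<rangle>)\<close>, and determinants are multiplicative.
\<close>
lemma wedges_in_span_orthonormal:
  assumes es: "orthonormal es" and us: "set us \<subseteq> vec.span (set es)" and len: "length us = length es"
  shows "wedges us = gram_det g es us *s wedges es"
proof (rule ext_inner_eqI_wedges)
  fix cs :: "('k, 'n) vector list"
  let ?m = "length es"
  let ?M = "\<lambda>vs ws. Matrix.mat (length vs) (length ws) (\<lambda>(i, j). g (vs ! i) (ws ! j))"
  show "ext_inner g (wedges cs) (wedges us) = ext_inner g (wedges cs) (gram_det g es us *s wedges es)"
  proof (cases "length cs = ?m")
    case True
    have expand: "g c u = (\<Sum>k<?m. g c (es ! k) * g (es ! k) u)" if "u \<in> set us" for c u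
    proof -
      have "u = proj es u" using proj_id[OF es] us that by force
      also have "\<dots> = (\<Sum>k<?m. g (es ! k) u *s es ! k)"
        unfolding proj_def using es
        by (subst sum.reindex_bij_betw[OF bij_betw_nth[of es, OF _ refl refl], symmetric])
           (auto simp: orthonormal_def)
      finally have "g c u = g c (\<Sum>k<?m. g (es ! k) u *s es ! k)" by (rule arg_cong)
      then show ?thesis by (simp add: sum_right scale_right mult.commute)
    qed
    have product: "?M cs us = ?M cs es * ?M es us"
      by (rule eq_matI) (auto simp: True len scalar_prod_def atLeast0LessThan intro!: expand)
    have "Determinant.det (?M cs es * ?M es us) = Determinant.det (?M cs es) * Determinant.det (?M es us)"
      by (rule Determinant.det_mult[of _ ?m])
         (rule carrier_matI; simp only: dim_row_mat dim_col_mat True len)+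
    then have "gram_det g cs us = gram_det g cs es * gram_det g es us"
      unfolding gram_det_def product .
    then show ?thesis
      using True len by (simp add: ext_inner_wedges[OF inner_product] ext_inner_scale_right mult.commute)
  next
    case False
    then show ?thesis by (simp add: ext_inner_wedges_orthogonal ext_inner_scale_right len)
  qed
qed

section \<open>The space of a blade\<close>

text \<open>
  A nonzero blade determines its space. If \<open>v\<close> is not in the span, its component \<open>u\<close> orthogonal to the
  span is nonzero, and \<open>v \<and> A = u \<and> A\<close> has squared norm \<open>\<parallel>u\<parallel>\<^sup>2 \<parallel>A\<parallel>\<^sup>2 \<noteq> 0\<close> since the Gram matrix of
  \<open>u # vs\<close> is block diagonal.
\<close>
lemma span_wedges:
  fixes vs :: "('k, 'n) vector list"
  assumes "wedges vs \<noteq> 0"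
  shows "vec.span (set vs) = {v. wedge (of_vector v) (wedges vs) = 0}"
proof (intro equalityI subsetI CollectI)
  fix v assume "v \<in> {v. wedge (of_vector v) (wedges vs) = 0}"
  then have 0: "wedge (of_vector v) (wedges vs) = 0" by simp
  obtain es where es: "orthonormal es" "vec.span (set es) = vec.span (set vs)"
    using orthonormal_basis[OF vec.subspace_span] by metis
  define u where "u = v - proj es v"
  have P: "proj es v \<in> vec.span (set vs)" using proj_in_span[of es v] es(2) by simp
  have "v = u + proj es v" by (simp add: u_def)
  then have "of_vector v = of_vector u + of_vector (proj es v)"
    by (metis of_vector_add)
  with 0 have "wedges (u # vs) = 0"
    by (simp add: wedge_add_left wedge_of_vector_wedges_span[OF P])
  then have "gram_det g ([u] @ vs) ([u] @ vs) = 0"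
    using ext_inner_wedges[OF inner_product, of "u # vs" "u # vs"] by (simp del: wedges.simps)
  moreover have "g u x = 0" if "x \<in> set vs" for x
  proof -
    have "x \<in> vec.span (set es)" using that es(2) by (simp add: vec.span_base)
    then have "g x u = 0" using proj_inner[OF es(1)] by (simp add: u_def diff_right)
    then show ?thesis by (rule orthogonal_sym)
  qed
  ultimately have "gram_det g [u] [u] * gram_det g vs vs = 0"
    by (subst (asm) gram_det_block) auto
  moreover have "gram_det g vs vs \<noteq> 0"
    using assms ext_inner_wedges[OF inner_product, of vs vs] ext_inner_self[of "wedges vs"] by auto
  ultimately have "gram_det g [u] [u] = 0" by simp
  then have "g u u = 0" by (simp add: gram_det_def Determinant.det_single)
  then have "v = proj es v" by (simp add: eq_0_iff u_def)
  then show "v \<in> vec.span (set vs)" using P by simp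
qed (simp add: wedge_of_vector_wedges_span)

lemma wedge_of_vector_eq_0_represents:
  fixes A :: "('k, 'n) multivector"
  assumes "represents A V"
  shows "V = {v. wedge (of_vector v) A = 0}"
  using assms by (elim representsE) (simp add: span_wedges wedge_scale_right)

lemma blade_space_eq:
  fixes A :: "('k, 'n) multivector"
  shows "represents A V \<Longrightarrow> blade_space A = V"
  unfolding blade_space_def using wedge_of_vector_eq_0_represents by (intro the_equality) blast+

lemma represents_proportional:
  assumes "represents A V" "orthonormal es" "vec.span (set es) = V"
  obtains c where "c \<noteq> 0" "A = c *s wedges es"
proof -
  obtain \<kappa> vs where vs: "\<kappa> \<noteq> 0" "wedges vs \<noteq> 0" "A = \<kappa> *s wedges vs" "V = vec.span (set vs)"
    using assms(1) by (rule representsE)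
  have "length vs = length es"
    using length_eq_dim_span[OF vs(2)] orthonormal_length[OF assms(2)] assms(3) vs(4) by simp
  then have "wedges vs = gram_det g es vs *s wedges es"
    using assms(2,3) vs(4) vec.span_superset[of "set vs"] by (intro wedges_in_span_orthonormal) auto
  then show thesis using vs by (intro that[of "\<kappa> * gram_det g es vs"]) auto
qed

section \<open>Projection of multivectors and the asymmetric angle\<close>

lemma wedges_in_exterior_subalgebra: "set ws \<subseteq> W \<Longrightarrow> wedges ws \<in> exterior_subalgebra W"
  unfolding exterior_subalgebra_def by (intro vec.span_base) auto

lemma ext_map_proj_symmetric:
  assumes "orthonormal es"
  shows "ext_inner g (ext_map (proj es) a) b = ext_inner g a (ext_map (proj es) b)"
proof (induction a rule: multivector_induct)
  case (wedges vs)
  show ?case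
  proof (induction b rule: multivector_induct)
    case (wedges ws)
    have "gram_det g (map (proj es) vs) ws = gram_det g vs (map (proj es) ws)"
      unfolding gram_det_def
      by (rule arg_cong[of _ _ Determinant.det], rule eq_matI) (auto simp: proj_symmetric[OF assms])
    then show ?case
      by (cases "length vs = length ws")
        (simp_all add: ext_map_wedges[OF proj_linear] ext_inner_wedges[OF inner_product]
          ext_inner_wedges_orthogonal)
  qed (simp_all add: ext_inner_linear_right ext_map_linear)
qed (simp_all add: ext_inner_linear_left ext_map_linear)

lemma ext_map_proj_id:
  assumes es: "orthonormal es" and c: "c \<in> exterior_subalgebra (vec.span (set es))"
  shows "ext_map (proj es) c = c"
proof -
  have "vec.subspace {c. ext_map (proj es) c = c}"
    using ext_map_linear[of "proj es" 1] by (simp add: vec.subspace_def ext_map_scale)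
  moreover have "map (proj es) ws = ws" if "set ws \<subseteq> vec.span (set es)" for ws
    using proj_id[OF es] that by (intro map_idI) auto
  then have "{wedges ws |ws. set ws \<subseteq> vec.span (set es)} \<subseteq> {c. ext_map (proj es) c = c}"
    by (auto simp: ext_map_wedges[OF proj_linear])
  ultimately show ?thesis
    using c vec.span_minimal unfolding exterior_subalgebra_def by blast
qed

lemma ext_map_proj_in:
  "ext_map (proj es) a \<in> exterior_subalgebra (vec.span (set es))"
  unfolding ext_map_def exterior_subalgebra_def
  by (intro vec.span_sum vec.span_scale wedges_in_exterior_subalgebra[unfolded exterior_subalgebra_def])
     (auto simp: proj_in_span)

text \<open>
  The orthogonal projection onto the subalgebra of \<open>W\<close> is thus the homomorphism induced by the
  orthogonal projection onto \<open>W\<close>. Uniqueness uses that the inner product is definite.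
\<close>
lemma ext_proj_eq:
  assumes es: "orthonormal es"
  shows "ext_proj g (vec.span (set es)) a = ext_map (proj es) a"
  unfolding ext_proj_def
proof (rule the_equality)
  let ?S = "exterior_subalgebra (vec.span (set es))"
  have inner: "ext_inner g c (ext_map (proj es) a) = ext_inner g c a" if "c \<in> ?S" for c
    using ext_map_proj_symmetric[OF es, of c a] ext_map_proj_id[OF es that] by simp
  then show "ext_map (proj es) a \<in> ?S \<and> (\<forall>c\<in>?S. ext_inner g c (a - ext_map (proj es) a) = 0)"
    by (simp add: ext_map_proj_in ext_inner_diff_right)
  fix b assume b: "b \<in> ?S \<and> (\<forall>c\<in>?S. ext_inner g c (a - b) = 0)"
  let ?d = "ext_map (proj es) a - b"
  have d: "?d \<in> ?S"
    using b ext_map_proj_in[of es a] unfolding exterior_subalgebra_def by (intro vec.span_diff) auto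
  have "ext_inner g ?d (a - b) = 0" using b d by blast
  then have "ext_inner g ?d ?d = 0"
    using inner[OF d] by (simp only: ext_inner_diff_right)
  then have "?d = 0" by (simp add: ext_inner_self)
  then show "b = ext_map (proj es) a" by simp
qed

text \<open>Pythagoras, for the orthogonal decomposition of \<open>a\<close> into its projection and the remainder.\<close>
lemma ext_norm_proj_le:
  assumes es: "orthonormal es"
  shows "ext_norm g (ext_map (proj es) a) \<le> ext_norm g a"
proof -
  let ?P = "ext_map (proj es)"
  have idem: "?P (?P b) = ?P b" for b by (rule ext_map_proj_id[OF es ext_map_proj_in])
  have "ext_inner g (a - ?P a) (?P a) = 0"
    unfolding ext_map_proj_symmetric[OF es, symmetric] by (simp add: ext_map_diff idem)
  moreover have "ext_inner g (?P a) a = ext_inner g (?P a) (?P a)"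
    using ext_map_proj_symmetric[OF es, of "?P a" a] by (simp add: idem)
  ultimately have "ext_inner g (a - ?P a) (a - ?P a) = ext_inner g a a - ext_inner g (?P a) (?P a)"
    by (simp add: ext_inner_diff_right ext_inner_diff_left)
  then have "of_real ((ext_norm g (a - ?P a))\<^sup>2) =
      (of_real ((ext_norm g a)\<^sup>2 - (ext_norm g (?P a))\<^sup>2) :: 'k)"
    by (simp only: ext_inner_self of_real_diff)
  then have "(ext_norm g (a - ?P a))\<^sup>2 = (ext_norm g a)\<^sup>2 - (ext_norm g (?P a))\<^sup>2"
    by (simp only: of_real_eq_iff)
  then have "(ext_norm g (?P a))\<^sup>2 \<le> (ext_norm g a)\<^sup>2"
    by (metis zero_le_power2 diff_ge_0_iff_ge)
  then show ?thesis by (rule power2_le_imp_le) simp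
qed

text \<open>
  Two blades that represent \<open>V\<close> are multiples of each other, so the ratio of norms that defines the
  angle is the same for both.
\<close>
lemma asym_angle_eq:
  assumes A: "represents A V" and es: "orthonormal es"
  shows "asym_angle g V (vec.span (set es)) =
    arccos (ext_norm g (ext_map (proj es) A) / ext_norm g A)"
  unfolding asym_angle_def
proof (rule the_equality)
  let ?W = "vec.span (set es)"
  show "\<forall>A'. represents A' V \<longrightarrow> arccos (ext_norm g (ext_map (proj es) A) / ext_norm g A) =
      arccos (ext_norm g (ext_proj g ?W A') / ext_norm g A')"
  proof (intro allI impI)
    fix A' assume A': "represents A' V"
    have "vec.subspace V" using A by (elim representsE) (simp add: vec.subspace_span)
    then obtain fs where fs: "orthonormal fs" "vec.span (set fs) = V" by (rule orthonormal_basis)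
    obtain c where c: "c \<noteq> 0" "A = c *s wedges fs"
      using represents_proportional[OF A fs] .
    obtain c' where c': "c' \<noteq> 0" "A' = c' *s wedges fs"
      using represents_proportional[OF A' fs] .
    show "arccos (ext_norm g (ext_map (proj es) A) / ext_norm g A) =
        arccos (ext_norm g (ext_proj g ?W A') / ext_norm g A')"
      using c c' by (simp add: ext_proj_eq[OF es] ext_map_scale ext_norm_scale)
  qed
  then show "\<theta> = arccos (ext_norm g (ext_map (proj es) A) / ext_norm g A)"
    if "\<forall>A'. represents A' V \<longrightarrow> \<theta> = arccos (ext_norm g (ext_proj g ?W A') / ext_norm g A')" for \<theta>
    using that A by simp
qed

lemma cos_asym_angle:
  assumes A: "represents A V" and es: "orthonormal es"
  shows "ext_norm g A * cos (asym_angle g V (vec.span (set es))) = ext_norm g (ext_map (proj es) A)"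
proof -
  have "A \<noteq> 0" using A by (simp add: represents_def)
  then have pos: "ext_norm g A > 0" using ext_norm_nonneg[of A] ext_norm_eq_0_iff[of A] by linarith
  let ?r = "ext_norm g (ext_map (proj es) A) / ext_norm g A"
  have "0 \<le> ?r" by simp
  moreover have "?r \<le> 1"
    using pos ext_norm_proj_le[OF es, of A] by simp
  ultimately have "cos (arccos ?r) = ?r" by (intro cos_arccos) linarith+
  then show ?thesis using pos by (simp add: asym_angle_eq[OF A es])
qed

text \<open>
  The projection of a blade is again a blade, \<open>P v\<^sub>1 \<and> \<dots> \<and> P v\<^sub>p\<close> up to a scalar. Unless it vanishes,
  an orthonormal basis \<open>es\<close> of the span of the \<open>P v\<^sub>i\<close> has \<open>p\<close> elements and extends to one of \<open>W\<close>.
\<close>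
lemma adapted_orthonormal_basis:
  assumes A: "represents A V" and W: "vec.subspace W"
  obtains a es fs where "orthonormal (es @ fs)" "vec.span (set (es @ fs)) = W"
    "ext_map (proj (es @ fs)) A = a *s wedges es" "a \<noteq> 0 \<Longrightarrow> length es = vec.dim V"
proof -
  obtain ws where ws: "orthonormal ws" "vec.span (set ws) = W" using W by (rule orthonormal_basis)
  obtain \<kappa> vs where vs: "\<kappa> \<noteq> 0" "wedges vs \<noteq> 0" "A = \<kappa> *s wedges vs" "V = vec.span (set vs)"
    using A by (rule representsE)
  let ?us = "map (proj ws) vs"
  have PA: "ext_map (proj ws) A = \<kappa> *s wedges ?us"
    by (simp add: vs(3) ext_map_scale ext_map_wedges[OF proj_linear])
  show thesis
  proof (cases "wedges ?us = 0")
    case True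
    \<comment> \<open>The scalar \<open>a = 0\<close> makes any splitting of the basis admissible.\<close>
    then show thesis using that[of "[]" ws 0] ws PA by simp
  next
    case False
    obtain es where es: "orthonormal es" "vec.span (set es) = vec.span (set ?us)"
      using vec.subspace_span by (rule orthonormal_basis)
    have len: "length es = length ?us"
      using length_eq_dim_span[OF False] orthonormal_length[OF es(1)] es(2) by simp
    have u: "wedges ?us = gram_det g es ?us *s wedges es"
      by (rule wedges_in_span_orthonormal[OF es(1)]) (simp_all only: es(2) vec.span_superset len)
    have "set ?us \<subseteq> W" using proj_in_span[of ws] ws(2) by auto
    then have "vec.span (set ?us) \<subseteq> W" using W by (rule vec.span_minimal)
    then have "set es \<subseteq> W" using es(2) vec.span_superset by blast
    from orthonormal_extend[OF W es(1) this] obtain fs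
      where fs: "orthonormal (es @ fs)" "vec.span (set (es @ fs)) = W" by blast
    have "ext_map (proj (es @ fs)) A = ext_map (proj ws) A"
      using ext_proj_eq[OF ws(1), of A] ext_proj_eq[OF fs(1), of A] by (simp only: ws(2) fs(2))
    then have "ext_map (proj (es @ fs)) A = (\<kappa> * gram_det g es ?us) *s wedges es"
      using PA u by simp
    moreover have "length es = vec.dim V" using len length_eq_dim_span[OF vs(2)] vs(4) by simp
    ultimately show thesis using that fs by blast
  qed
qed

section \<open>Contraction of blades\<close>

lemma contraction_eqI:
  assumes "\<And>C. ext_inner g C D = ext_inner g (wedge A C) B"
  shows "contraction g A B = D"
  unfolding contraction_def using assms by (intro the_equality ext_inner_eqI) simp_all

text \<open>
  Only the projection of \<open>A\<close> onto the space of \<open>B\<close> contributes to the contraction: the projection is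
  self-adjoint, multiplicative and idempotent, and it fixes \<open>B\<close>, so both sides equal \<open>\<langle>P A \<and> P C, B\<rangle>\<close>.
\<close>
lemma wedge_inner_proj:
  assumes es: "orthonormal es" and B: "ext_map (proj es) B = B"
  shows "ext_inner g (wedge A C) B = ext_inner g (wedge (ext_map (proj es) A) C) B"
proof -
  let ?P = "ext_map (proj es)"
  have idem: "?P (?P b) = ?P b" for b by (rule ext_map_proj_id[OF es ext_map_proj_in])
  have "ext_inner g (wedge A C) B = ext_inner g (?P (wedge A C)) B" for A
    using ext_map_proj_symmetric[OF es, of "wedge A C" B] B by simp
  then have P: "ext_inner g (wedge A C) B = ext_inner g (wedge (?P A) (?P C)) B" for A
    by (simp add: ext_map_wedge[OF proj_linear])
  show ?thesis using P[of A] P[of "?P A"] by (simp add: idem)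
qed

text \<open>
  The Gram matrix is block triangular, with the identity as its first block. As \<open>C\<close> is arbitrary, this
  means that \<open>(e\<^sub>1 \<and> \<dots> \<and> e\<^sub>p) \<lrcorner> (e\<^sub>1 \<and> \<dots> \<and> e\<^sub>q) = e\<^sub>p\<^sub>+\<^sub>1 \<and> \<dots> \<and> e\<^sub>q\<close> for an orthonormal system.
\<close>
lemma wedges_inner_orthonormal_append:
  assumes "orthonormal (es @ fs)"
  shows "ext_inner g (wedge (wedges es) C) (wedges (es @ fs)) = ext_inner g C (wedges fs)"
proof (induction C rule: multivector_induct)
  case (wedges cs)
  have es: "orthonormal es" and orth: "\<And>x w. x \<in> set es \<Longrightarrow> w \<in> set fs \<Longrightarrow> g x w = 0"
    using assms by (auto simp: orthonormal_def)
  show ?case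
  proof (cases "length cs = length fs")
    case True
    then have "gram_det g (es @ cs) (es @ fs) = gram_det g cs fs"
      using gram_det_block[OF refl True orth] gram_det_orthonormal[OF es] by simp
    then show ?thesis
      using True by (simp add: wedges_append[symmetric] ext_inner_wedges[OF inner_product])
  next
    case False
    then show ?thesis by (simp add: wedges_append[symmetric] ext_inner_wedges_orthogonal)
  qed
qed (simp_all add: wedge_add_right wedge_scale_right ext_inner_linear_left)

text \<open>
  In an adapted orthonormal basis, with \<open>\<Lambda> P A = a e\<^sub>1 \<and> \<dots> \<and> e\<^sub>p\<close> and \<open>B = b e\<^sub>1 \<and> \<dots> \<and> e\<^sub>q\<close>, all the
  quantities to be compared are \<open>\<bar>a\<bar> \<bar>b\<bar>\<close>.
\<close>
lemma contraction_norm: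
  assumes A: "represents A V" and B: "represents B W"
  shows "ext_norm g (contraction g A B) = ext_norm g A * ext_norm g B * cos (asym_angle g V W)"
    and "vec.dim V = vec.dim W \<Longrightarrow>
      norm (ext_inner g A B) = ext_norm g A * ext_norm g B * cos (asym_angle g V W)"
proof -
  have W: "vec.subspace W" using B by (elim representsE) (simp add: vec.subspace_span)
  obtain a es fs where on: "orthonormal (es @ fs)" and span: "vec.span (set (es @ fs)) = W"
    and PA: "ext_map (proj (es @ fs)) A = a *s wedges es"
    and len: "a \<noteq> 0 \<Longrightarrow> length es = vec.dim V"
    using adapted_orthonormal_basis[OF A W] by blast
  obtain b where b: "B = b *s wedges (es @ fs)"
    using represents_proportional[OF B on span] by blast
  have es: "orthonormal es" and fs: "orthonormal fs" using on by (auto simp: orthonormal_def)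
  have "wedges (es @ fs) \<in> exterior_subalgebra (vec.span (set (es @ fs)))"
    by (intro wedges_in_exterior_subalgebra vec.span_superset)
  then have PB: "ext_map (proj (es @ fs)) B = B"
    unfolding b ext_map_scale using ext_map_proj_id[OF on] by simp
  have reduce: "ext_inner g (wedge A C) B = ext_inner g C ((conjugate a * b) *s wedges fs)" for C
  proof -
    have "ext_inner g (wedge A C) B = ext_inner g (wedge (a *s wedges es) C) B"
      by (subst wedge_inner_proj[OF on PB]) (simp only: PA)
    also have "\<dots> = conjugate a * (b * ext_inner g (wedge (wedges es) C) (wedges (es @ fs)))"
      unfolding b wedge_scale_left ext_inner_scale_left ext_inner_scale_right by (rule mult.left_commute)
    also have "\<dots> = ext_inner g C ((conjugate a * b) *s wedges fs)"
      unfolding wedges_inner_orthonormal_append[OF on] by (simp add: ext_inner_scale_right mult.assoc)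
    finally show ?thesis .
  qed
  have rhs: "ext_norm g A * ext_norm g B * cos (asym_angle g V W) = norm a * norm b"
  proof -
    have "ext_norm g A * cos (asym_angle g V W) = norm a"
      using cos_asym_angle[OF A on] unfolding span PA
      by (simp add: ext_norm_scale ext_norm_wedges_orthonormal[OF es])
    moreover have "ext_norm g B = norm b"
      by (simp only: b ext_norm_scale ext_norm_wedges_orthonormal[OF on] mult_1_right)
    ultimately show ?thesis by (metis mult.assoc mult.commute)
  qed
  \<comment> \<open>The contraction is a multiple of the blade complementary to \<open>es\<close> in the space of \<open>B\<close>.\<close>
  have "contraction g A B = (conjugate a * b) *s wedges fs"
    by (rule contraction_eqI) (simp add: reduce)
  then show "ext_norm g (contraction g A B) = ext_norm g A * ext_norm g B * cos (asym_angle g V W)"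
    unfolding rhs by (simp add: ext_norm_scale ext_norm_wedges_orthonormal[OF fs] norm_mult)
  assume dim: "vec.dim V = vec.dim W"
  \<comment> \<open>For \<open>C = 1\<close>, the adjunction expresses the inner product itself by the contraction.\<close>
  have "ext_inner g A B = ext_inner g (wedges []) ((conjugate a * b) *s wedges fs)"
    using reduce[of "wedges []"] by (simp add: wedge_of_scalar)
  also have "norm \<dots> = norm a * norm b"
  proof (cases "a = 0")
    case False
    have "length (es @ fs) = vec.dim W" using orthonormal_length[OF on] unfolding span .
    then have "fs = []" using len[OF False] dim by simp
    then show ?thesis by (simp add: ext_inner_scale_right ext_inner_of_scalar norm_mult)
  qed simp
  finally show "norm (ext_inner g A B) = ext_norm g A * ext_norm g B * cos (asym_angle g V W)"
    unfolding rhs .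
qed

end

theorem proposition3p20:
  fixes g :: "('k::real_or_complex, 'n::{finite,linorder}) vector \<Rightarrow> ('k, 'n) vector \<Rightarrow> 'k"
    and A B :: "('k, 'n) multivector"
    and p q :: nat
  assumes "inner_product g"
    and "is_blade p A"
    and "is_blade q B"
  shows "ext_norm g (contraction g A B)
           = ext_norm g A * ext_norm g B * cos (asym_angle g (blade_space A) (blade_space B)) \<and>
         (p = q \<longrightarrow>
           norm (ext_inner g A B)
             = ext_norm g A * ext_norm g B * cos (asym_angle g (blade_space A) (blade_space B)))"
proof -
  interpret exterior_inner_product g using assms(1) by unfold_locales
  show ?thesis
  proof (cases "A = 0 \<or> B = 0")
    case True
    have "contraction g A B = 0"
      by (rule contraction_eqI) (use True in auto)
    then show ?thesis using True by auto
  next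
    case False
    obtain V where V: "represents A V" "vec.dim V = p" using assms(2) False by (auto elim: is_bladeE)
    obtain W where W: "represents B W" "vec.dim W = q" using assms(3) False by (auto elim: is_bladeE)
    show ?thesis
      unfolding blade_space_eq[OF V(1)] blade_space_eq[OF W(1)]
      using contraction_norm[OF V(1) W(1)] V(2) W(2) by simp
  qed
qed

end
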